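(* Let $g\ge1$ be an integer. There exists an isomorphism of $\mathbb C[[h,h']]$-algebras $$\psi:\ U_{h,h'}(\mathfrak{sl}_2,g)\ \stackrel{\sim}{\longrightarrow}\ U(\mathfrak{sl}_2)[[h,h']],$$ where $U(\mathfrak{sl}_2)[[h,h']]$ denotes the constant formal deformation of $U(\mathfrak{sl}_2)$, such that $\psi(H)=\bar H$, $\psi(C)=\bar C$, $\psi(X^-)=\bar X^-$ and $$\psi(X^+)=\left(\prod_{e=1,-1}\frac{\big(Q\,T^{\{\bar H_e^+\}_Q}\big)^{\bar H_e^+}-\big(Q\,T^{\{\bar H_e^+\}_Q}\big)^{-\bar H_e^+}}{\bar H_e^+\big(Q\,T^{\{\bar H_e^+\}_Q}-Q^{-1}T^{-\{\bar H_e^+\}_Q}\big)}\right)\bar X^+ .$$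
   Context: For a vector space $V$, $V[[h,h']]$ is the space of formal power series with coefficients in $V$. The $\mathbb C[[h,h']]$-algebra topologically generated by a set $X$ with relations $\mathcal R$ is $\mathbb C\langle X\rangle[[h,h']]$ modulo the $(h,h')$-adic closure of the two-sided ideal generated by $\mathcal R$. Definition of $U_{h,h'}(\mathfrak{sl}_2,g)$. Let $\varepsilon=\exp(i\pi/g)$, $Q=\exp(h)$, $T=\exp(h')$, $$P(u)=\tfrac12\left(u^{g-1}+u^{1-g}\right)\prod_{k=1}^{g-1}\frac{\varepsilon^k u-\varepsilon^{-k}u^{-1}}{\varepsilon^k-\varepsilon^{-k}}.$$ $U_{h,h'}(\mathfrak{sl}_2,g)$ is the $\mathbb C[[h,h']]$-algebra topologically generated by $X^+,X^-,H,C$ with relations $[C,X^\pm]=[C,H]=0$, $[H,X^\pm]=\pm2X^\pm$, $$X^\pm X^\mp=\prod_{e=1,-1}\frac{\left(Q\,T^{\{H_e^\pm\}_Q}\right)^{H_e^\pm}-\left(Q\,T^{\{H_e^\pm\}_Q}\right)^{-H_e^\pm}}{Q\,T^{\{H_e^\pm\}_Q}-Q^{-1}T^{-\{H_e^\pm\}_Q}},$$ where $H_e^\pm=\frac12(\sqrt C+eH\mp e)$, $\{H_e^\pm\}_Q=P(Q^{H_e^\pm})$. Numerator and denominator are series in $\mathbb C[H,\sqrt C][[h,h']]$ ($H,\sqrt C$ polynomial variables), each divided by $h+h'\{H_e^\pm\}_Q$ before the quotient is taken; the product over $e$ is invariant under $\sqrt C\mapsto-\sqrt C$, and $(\sqrt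 C)^2$ is replaced by $C$. $U(\mathfrak{sl}_2)$ has generators $\bar X^\pm,\bar H$ with $[\bar H,\bar X^\pm]=\pm2\bar X^\pm$, $[\bar X^+,\bar X^-]=\bar H$, and $\bar C=(\bar H+1)^2+4\bar X^-\bar X^+$ is its (central) Casimir element. The constant formal deformation $U(\mathfrak{sl}_2)[[h,h']]$ carries the $\mathbb C[[h,h']]$-bilinear extension of the product of $U(\mathfrak{sl}_2)$ to power series. $\bar H_e^+=\frac12(\sqrt{\bar C}+e\bar H-e)$, $\{\bar H_e^+\}_Q=P(Q^{\bar H_e^+})$. In the formula for $\psi(X^+)$: in $\mathbb C[\bar H,\sqrt{\bar C}][[h,h']]$, the numerator $2\sinh\big((h+h'\{\bar H_e^+\}_Q)\bar H_e^+\big)$ is divided by $(h+h'\{\bar H_e^+\}_Q)\bar H_e^+$, the factor $2\sinh(h+h'\{\bar H_e^+\}_Q)$ of the denominator by $h+h'\{\bar H_e^+\}_Q$, and the quotient of the resulting series is taken; the product over $e$ is even in $\sqrt{\bar C}$, and $(\sqrt{\bar C})^2$ is replaced by $\bar C$. *)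

theory Defs
  imports
    "HOL-Algebra.Algebraic_Closure_Type"
    "HOL-Algebra.QuotRing"
    "HOL-Algebra.Module"
    "HOL-Library.Poly_Mapping"
    "HOL-Computational_Algebra.Polynomial"
    "HOL-Computational_Algebra.Formal_Power_Series"
    Complex_Main
begin

section \<open>Free associative algebras\<close>

datatype 'x free_monoid = Word (letters: "'x list")

instantiation free_monoid :: (type) monoid_add
begin

definition zero_free_monoid :: "'a free_monoid" where
  "0 = Word []"

definition plus_free_monoid :: "'a free_monoid \<Rightarrow> 'a free_monoid \<Rightarrow> 'a free_monoid" where
  "u + v = Word (letters u @ letters v)"

instance
  by standard (auto simp: zero_free_monoid_def plus_free_monoid_def)

end

lemma free_monoid_sum_zero_iff: "u + v = 0 \<longleftrightarrow> u = 0 \<and> v = (0 :: 'x free_monoid)"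
  by (cases u; cases v) (auto simp: zero_free_monoid_def plus_free_monoid_def)

text \<open>The monoid algebra \<open>\<complex>\<langle>X\<rangle>\<close> of the free monoid on \<open>X\<close>; multiplication is convolution along
  concatenation of words.\<close>

type_synonym 'x free_algebra = "'x free_monoid \<Rightarrow>\<^sub>0 complex"

definition free_gen :: "'x \<Rightarrow> 'x free_algebra" where
  "free_gen x = Poly_Mapping.single (Word [x]) 1"

definition free_scalar :: "complex \<Rightarrow> 'x free_algebra" where
  "free_scalar c = Poly_Mapping.single 0 c"


section \<open>The algebra \<open>U(sl\<^sub>2)\<close>\<close>

datatype sl2_gen = SXp | SXm | SH

definition sl2_relations :: "sl2_gen free_algebra set" where
  "sl2_relations =
    (let Xp = free_gen SXp; Xm = free_gen SXm; H = free_gen SH in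
      {H * Xp - Xp * H - 2 * Xp,
       H * Xm - Xm * H + 2 * Xm,
       Xp * Xm - Xm * Xp - H})"

definition sl2_ideal :: "sl2_gen free_algebra set" where
  "sl2_ideal = genideal ring_of_type_algebra sl2_relations"

lemma ring_of_type_algebra_simps [simp]:
  "carrier ring_of_type_algebra = UNIV"
  "monoid.mult ring_of_type_algebra = (*)"
  "monoid.one ring_of_type_algebra = 1"
  "ring.zero ring_of_type_algebra = 0"
  "ring.add ring_of_type_algebra = (+)"
  by (simp_all add: ring_of_type_algebra_def)

lemma ring_ring_of_type_algebra: "ring (ring_of_type_algebra :: 'a :: ring_1 ring)"
proof -
  have "\<exists>y. x + y = 0" for x :: 'a
    using add.right_inverse by blast
  then show ?thesis
    unfolding ring_of_type_algebra_def using add.right_inverse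
    by unfold_locales (auto simp: algebra_simps Units_def)
qed

lemma ideal_of_type_algebraI:
  fixes I :: "'a :: ring_1 set"
  assumes "0 \<in> I" "\<And>x y. x \<in> I \<Longrightarrow> y \<in> I \<Longrightarrow> x + y \<in> I"
    "\<And>x y. x \<in> I \<Longrightarrow> y * x \<in> I" "\<And>x y. x \<in> I \<Longrightarrow> x * y \<in> I"
  shows "ideal I ring_of_type_algebra"
proof -
  interpret R: ring "ring_of_type_algebra :: 'a ring"
    by (rule ring_ring_of_type_algebra)
  have minus: "\<ominus>\<^bsub>ring_of_type_algebra\<^esub> x = - x" for x :: 'a
    by (rule R.minus_equality) auto
  have inv: "inv\<^bsub>add_monoid ring_of_type_algebra\<^esub> x = - x" for x :: 'a
    using minus[of x] unfolding a_inv_def .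
  have neg: "- x \<in> I" if "x \<in> I" for x
    using assms(3)[OF that, of "-1"] by simp
  show ?thesis
    by (rule idealI[OF R.ring_axioms], rule group.subgroupI[OF R.a_group])
      (use assms neg in \<open>auto simp: inv[simplified]\<close>)
qed

lemma ideal_of_type_algebraD:
  fixes I :: "'a :: ring_1 set"
  assumes "ideal I ring_of_type_algebra"
  shows "0 \<in> I" "x \<in> I \<Longrightarrow> y \<in> I \<Longrightarrow> x + y \<in> I"
    "x \<in> I \<Longrightarrow> y * x \<in> I" "x \<in> I \<Longrightarrow> x * y \<in> I" "x \<in> I \<Longrightarrow> - x \<in> I"
    "x \<in> I \<Longrightarrow> y \<in> I \<Longrightarrow> x - y \<in> I"
proof -
  interpret I: ideal I "ring_of_type_algebra :: 'a ring" by fact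
  show "0 \<in> I" using additive_subgroup.zero_closed[OF I.is_additive_subgroup] by simp
  show add: "x \<in> I \<Longrightarrow> y \<in> I \<Longrightarrow> x + y \<in> I" for x y using additive_subgroup.a_closed[OF I.is_additive_subgroup, of x y] by simp
  show mult: "x \<in> I \<Longrightarrow> y * x \<in> I" for x y using I.I_l_closed[of x y] by simp
  show "x \<in> I \<Longrightarrow> x * y \<in> I" using I.I_r_closed[of x y] by simp
  show "x \<in> I \<Longrightarrow> - x \<in> I" using mult[of x "-1"] by simp
  show "x \<in> I \<Longrightarrow> y \<in> I \<Longrightarrow> x - y \<in> I" using add[of x "-y"] mult[of y "-1"] by simp
qed

lemma ideal_sl2_ideal: "ideal sl2_ideal ring_of_type_algebra"
  unfolding sl2_ideal_def by (rule ring.genideal_ideal[OF ring_ring_of_type_algebra]) simp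

lemmas sl2_idealD = ideal_of_type_algebraD[OF ideal_sl2_ideal]

lemma lookup_mult_zero_free_monoid:
  fixes x y :: "'x free_algebra"
  shows "Poly_Mapping.lookup (x * y) 0 = Poly_Mapping.lookup x 0 * Poly_Mapping.lookup y 0"
proof -
  have "Poly_Mapping.lookup (x * y) 0 =
      (\<Sum>l. Poly_Mapping.lookup x l * (\<Sum>q. Poly_Mapping.lookup y q when 0 = l + q))"
    by (simp add: lookup_mult)
  also have "(\<lambda>l. Poly_Mapping.lookup x l * (\<Sum>q. Poly_Mapping.lookup y q when 0 = l + q)) =
      (\<lambda>l. (Poly_Mapping.lookup x 0 * Poly_Mapping.lookup y 0) when l = 0)"
  proof
    fix l :: "'x free_monoid"
    have "(\<lambda>q. Poly_Mapping.lookup y q when 0 = l + q) =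
        (\<lambda>q. (Poly_Mapping.lookup y 0 when l = 0) when q = 0)"
      by (auto simp: fun_eq_iff when_def free_monoid_sum_zero_iff eq_commute[of "0 :: 'x free_monoid"])
    then show "Poly_Mapping.lookup x l * (\<Sum>q. Poly_Mapping.lookup y q when 0 = l + q) =
        ((Poly_Mapping.lookup x 0 * Poly_Mapping.lookup y 0) when l = 0)"
      by (simp only: Sum_any_when_equal) (simp add: when_def)
  qed
  finally show ?thesis by simp
qed

lemma one_notin_sl2_ideal: "1 \<notin> sl2_ideal"
proof -
  let ?Z = "{x :: sl2_gen free_algebra. Poly_Mapping.lookup x 0 = 0}"
  have "ideal ?Z ring_of_type_algebra"
    by (rule ideal_of_type_algebraI) (auto simp: lookup_add lookup_mult_zero_free_monoid)
  moreover have "Poly_Mapping.lookup (free_gen a) 0 = 0" for a :: sl2_gen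
    by (simp add: free_gen_def lookup_single zero_free_monoid_def)
  then have "sl2_relations \<subseteq> ?Z"
    by (auto simp: sl2_relations_def Let_def lookup_add lookup_minus lookup_mult_zero_free_monoid)
  ultimately have "sl2_ideal \<subseteq> ?Z"
    unfolding sl2_ideal_def by (rule ring.genideal_minimal[OF ring_ring_of_type_algebra])
  then show ?thesis by (auto simp: lookup_one)
qed

definition sl2_cong :: "sl2_gen free_algebra \<Rightarrow> sl2_gen free_algebra \<Rightarrow> bool" where
  "sl2_cong x y \<longleftrightarrow> x - y \<in> sl2_ideal"

quotient_type U_sl2 = "sl2_gen free_algebra" / sl2_cong
proof (rule equivpI)
  show "reflp sl2_cong"
    by (auto simp: reflp_def sl2_cong_def sl2_idealD(1))
  show "symp sl2_cong"
    unfolding symp_def sl2_cong_def using sl2_idealD(5) by fastforce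
  show "transp sl2_cong"
    unfolding transp_def sl2_cong_def
  proof safe
    fix x y z assume "x - y \<in> sl2_ideal" "y - z \<in> sl2_ideal"
    then have "(x - y) + (y - z) \<in> sl2_ideal" by (rule sl2_idealD(2))
    then show "x - z \<in> sl2_ideal" by simp
  qed
qed

instantiation U_sl2 :: ring_1
begin

lift_definition zero_U_sl2 :: U_sl2 is 0 .

lift_definition one_U_sl2 :: U_sl2 is 1 .

lift_definition plus_U_sl2 :: "U_sl2 \<Rightarrow> U_sl2 \<Rightarrow> U_sl2" is "(+)"
proof -
  fix a b c d :: "sl2_gen free_algebra"
  assume "sl2_cong a b" "sl2_cong c d"
  then have "(a - b) + (c - d) \<in> sl2_ideal"
    unfolding sl2_cong_def by (rule sl2_idealD(2))
  then show "sl2_cong (a + c) (b + d)"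
    by (simp add: sl2_cong_def algebra_simps)
qed

lift_definition uminus_U_sl2 :: "U_sl2 \<Rightarrow> U_sl2" is uminus
proof -
  fix a b :: "sl2_gen free_algebra"
  assume "sl2_cong a b"
  then have "- (a - b) \<in> sl2_ideal"
    unfolding sl2_cong_def by (rule sl2_idealD(5))
  then show "sl2_cong (- a) (- b)"
    by (simp add: sl2_cong_def)
qed

lift_definition minus_U_sl2 :: "U_sl2 \<Rightarrow> U_sl2 \<Rightarrow> U_sl2" is "(-)"
proof -
  fix a b c d :: "sl2_gen free_algebra"
  assume "sl2_cong a b" "sl2_cong c d"
  then have "(a - b) - (c - d) \<in> sl2_ideal"
    unfolding sl2_cong_def by (rule sl2_idealD(6))
  then show "sl2_cong (a - c) (b - d)"
    by (simp add: sl2_cong_def algebra_simps)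
qed

lift_definition times_U_sl2 :: "U_sl2 \<Rightarrow> U_sl2 \<Rightarrow> U_sl2" is "(*)"
proof -
  fix a b c d :: "sl2_gen free_algebra"
  assume "sl2_cong a b" "sl2_cong c d"
  then have "(a - b) * c + b * (c - d) \<in> sl2_ideal"
    unfolding sl2_cong_def by (intro sl2_idealD(2)[OF sl2_idealD(4) sl2_idealD(3)])
  then show "sl2_cong (a * c) (b * d)"
    by (simp add: sl2_cong_def algebra_simps)
qed

instance
proof
  show "(0 :: U_sl2) \<noteq> 1"
    by transfer (use one_notin_sl2_ideal sl2_idealD(5) in \<open>force simp: sl2_cong_def\<close>)
qed (transfer; simp add: sl2_cong_def sl2_idealD(1) algebra_simps)+

end

definition sl2_scalar :: "complex \<Rightarrow> U_sl2" where
  "sl2_scalar c = abs_U_sl2 (free_scalar c)"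

definition sl2_Xp :: U_sl2 where "sl2_Xp = abs_U_sl2 (free_gen SXp)"
definition sl2_Xm :: U_sl2 where "sl2_Xm = abs_U_sl2 (free_gen SXm)"
definition sl2_H :: U_sl2 where "sl2_H = abs_U_sl2 (free_gen SH)"

definition sl2_C :: U_sl2 where
  "sl2_C = (sl2_H + 1)^2 + 4 * sl2_Xm * sl2_Xp"


section \<open>Power series in \<open>h\<close> and \<open>h'\<close>\<close>

text \<open>\<open>V[[h,h']]\<close> is represented as \<open>V[[h]][[h']]\<close>: the coefficient of \<open>h\<^sup>a h'\<^sup>b\<close> in \<open>f\<close> is
  \<open>f $ b $ a\<close>. For noncommutative \<open>V\<close> the variables \<open>h\<close> and \<open>h'\<close> are still central.\<close>

definition hh_h :: "'a :: ring_1 fps fps" where "hh_h = fps_const fps_X"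
definition hh_h' :: "'a :: ring_1 fps fps" where "hh_h' = fps_X"

definition hh_const :: "'a :: ring_1 \<Rightarrow> 'a fps fps" where
  "hh_const a = fps_const (fps_const a)"

definition hh_map :: "('a :: ring_1 \<Rightarrow> 'b :: ring_1) \<Rightarrow> 'a fps fps \<Rightarrow> 'b fps fps" where
  "hh_map \<phi> f = Abs_fps (\<lambda>b. Abs_fps (\<lambda>a. \<phi> (f $ b $ a)))"

text \<open>If \<open>\<eta> :: \<complex> \<rightarrow> A\<close> is the structure map of a \<open>\<complex>\<close>-algebra \<open>A\<close>, then \<open>hh_algebra \<eta>\<close> is the
  \<open>\<complex>[[h,h']]\<close>-algebra \<open>A[[h,h']]\<close>. (The library record \<open>module\<close> consists of the ring operations together
  with a scalar multiplication, and does not presuppose commutativity.)\<close>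

definition hh_algebra ::
    "(complex \<Rightarrow> 'a :: ring_1) \<Rightarrow> (complex fps fps, 'a fps fps) module" where
  "hh_algebra \<eta> = ring.extend ring_of_type_algebra (module.fields (\<lambda>c f. hh_map \<eta> c * f))"

text \<open>The ideal \<open>(h,h')\<^sup>n\<close>.\<close>

definition hh_power :: "nat \<Rightarrow> 'a :: ring_1 fps fps set" where
  "hh_power n = genideal ring_of_type_algebra {hh_h ^ i * hh_h' ^ j | i j. i + j = n}"

definition hh_closure :: "'a :: ring_1 fps fps set \<Rightarrow> 'a fps fps set" where
  "hh_closure S = {f. \<forall>n. \<exists>s\<in>S. f - s \<in> hh_power n}"

definition quotient_algebra :: "('k, 'a) module \<Rightarrow> 'a set \<Rightarrow> ('k, 'a set) module" where
  "quotient_algebra A J =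
    ring.extend (A Quot J) (module.fields (\<lambda>c S. \<Union>x\<in>S. J +>\<^bsub>A\<^esub> (c \<odot>\<^bsub>A\<^esub> x)))"

text \<open>Isomorphisms of algebras over the ring whose elements are all elements of the type \<open>'k\<close>.\<close>

definition algebra_iso :: "('k, 'a) module \<Rightarrow> ('k, 'b) module \<Rightarrow> ('a \<Rightarrow> 'b) set" where
  "algebra_iso A B =
    {\<psi> \<in> ring_iso A B. \<forall>c. \<forall>x\<in>carrier A. \<psi> (c \<odot>\<^bsub>A\<^esub> x) = c \<odot>\<^bsub>B\<^esub> \<psi> x}"

lemma ideal_hh_power: "ideal (hh_power n) ring_of_type_algebra"
  unfolding hh_power_def by (rule ring.genideal_ideal[OF ring_ring_of_type_algebra]) simp

lemma ideal_hh_closure: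
  assumes "ideal I ring_of_type_algebra"
  shows "ideal (hh_closure I) ring_of_type_algebra"
proof (rule ideal_of_type_algebraI)
  note P = ideal_of_type_algebraD[OF ideal_hh_power]
  note I = ideal_of_type_algebraD[OF assms]
  show "0 \<in> hh_closure I"
    unfolding hh_closure_def using I(1) P(1) by force
  show "x + y \<in> hh_closure I" if xy: "x \<in> hh_closure I" "y \<in> hh_closure I" for x y
    unfolding hh_closure_def
  proof safe
    fix n
    obtain s t where "s \<in> I" "x - s \<in> hh_power n" "t \<in> I" "y - t \<in> hh_power n"
      using xy unfolding hh_closure_def by blast
    then show "\<exists>s\<in>I. x + y - s \<in> hh_power n"
      using P(2)[of "x - s" n "y - t"] I(2)[of s t] by (intro bexI[of _ "s + t"]) (auto simp: algebra_simps)
  qed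
  show "y * x \<in> hh_closure I" if x: "x \<in> hh_closure I" for x y
    unfolding hh_closure_def
  proof safe
    fix n
    obtain s where "s \<in> I" "x - s \<in> hh_power n"
      using x unfolding hh_closure_def by blast
    then show "\<exists>s\<in>I. y * x - s \<in> hh_power n"
      using P(3)[of "x - s" n y] I(3)[of s y] by (intro bexI[of _ "y * s"]) (auto simp: algebra_simps)
  qed
  show "x * y \<in> hh_closure I" if x: "x \<in> hh_closure I" for x y
    unfolding hh_closure_def
  proof safe
    fix n
    obtain s where "s \<in> I" "x - s \<in> hh_power n"
      using x unfolding hh_closure_def by blast
    then show "\<exists>s\<in>I. x * y - s \<in> hh_power n"
      using P(4)[of "x - s" n y] I(4)[of s y] by (intro bexI[of _ "s * y"]) (auto simp: algebra_simps)
  qed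
qed


section \<open>Series with coefficients in \<open>\<complex>[H, \<surd>C]\<close>\<close>

text \<open>Elements of \<open>\<complex>[H][\<surd>C]\<close> are of type \<open>complex poly poly\<close>, the outer variable being \<open>\<surd>C\<close>.\<close>

type_synonym pser = "complex poly poly fps fps"

definition ps_scalar :: "complex \<Rightarrow> pser" where "ps_scalar c = hh_const [:[:c:]:]"
definition ps_H :: pser where "ps_H = hh_const [:[:0, 1:]:]"
definition ps_sqrtC :: pser where "ps_sqrtC = hh_const [:0, 1:]"

text \<open>The exponential of a series \<open>f\<close> without constant term. As \<open>f\<^sup>n\<close> then has no monomials of total
  degree less than \<open>n\<close>, only the terms with \<open>n \<le> a + b\<close> contribute to the coefficient of
  \<open>h\<^sup>a h'\<^sup>b\<close> of \<open>\<Sum>n. f\<^sup>n / n!\<close>.\<close>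

definition ps_exp :: "pser \<Rightarrow> pser" where
  "ps_exp f = Abs_fps (\<lambda>b. Abs_fps (\<lambda>a.
     \<Sum>n\<le>a + b. (ps_scalar (1 / fact n) * f ^ n) $ b $ a))"

text \<open>Exact quotient in the integral domain \<open>\<complex>[H, \<surd>C][[h,h']]\<close>; it is only formed when \<open>d \<noteq> 0\<close>
  divides \<open>f\<close>.\<close>

definition ps_quot :: "pser \<Rightarrow> pser \<Rightarrow> pser" where
  "ps_quot f d = (THE q. d * q = f)"

text \<open>\<open>P(u)\<close> for invertible \<open>u\<close>, where \<open>v\<close> stands for \<open>u\<^sup>-\<^sup>1\<close>.\<close>

definition P_fun :: "nat \<Rightarrow> pser \<Rightarrow> pser \<Rightarrow> pser" where
  "P_fun g u v =
    (let \<epsilon> = exp (\<i> * complex_of_real pi / of_nat g) in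
      ps_scalar (1 / 2) * (u ^ (g - 1) + v ^ (g - 1)) *
      (\<Prod>k = 1..g - 1. ps_scalar (1 / (\<epsilon> ^ k - inverse \<epsilon> ^ k)) *
         (ps_scalar (\<epsilon> ^ k) * u - ps_scalar (inverse \<epsilon> ^ k) * v)))"

text \<open>\<open>{x}\<^sub>Q = P(Q\<^sup>x)\<close> with \<open>Q\<^sup>x = exp(h x)\<close>.\<close>

definition bracket_Q :: "nat \<Rightarrow> pser \<Rightarrow> pser" where
  "bracket_Q g x = P_fun g (ps_exp (hh_h * x)) (ps_exp (- (hh_h * x)))"

text \<open>The logarithm \<open>h + h' {x}\<^sub>Q\<close> of \<open>Q T\<^bsup>{x}\<^sub>Q\<^esup>\<close>, and the power \<open>(Q T\<^bsup>{x}\<^sub>Q\<^esup>)\<^sup>y\<close>.\<close>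

definition log_QT :: "nat \<Rightarrow> pser \<Rightarrow> pser" where
  "log_QT g x = hh_h + hh_h' * bracket_Q g x"

definition QT_power :: "nat \<Rightarrow> pser \<Rightarrow> pser \<Rightarrow> pser" where
  "QT_power g x y = ps_exp (log_QT g x * y)"

definition QT_num :: "nat \<Rightarrow> pser \<Rightarrow> pser" where
  "QT_num g x = QT_power g x x - QT_power g x (- x)"

definition QT_den :: "nat \<Rightarrow> pser \<Rightarrow> pser" where
  "QT_den g x = QT_power g x 1 - QT_power g x (- 1)"

text \<open>\<open>H_e e s\<close> is \<open>H\<^sub>e\<^sup>+\<close> for \<open>s = 1\<close> and \<open>H\<^sub>e\<^sup>-\<close> for \<open>s = -1\<close>.\<close>

definition H_e :: "complex \<Rightarrow> complex \<Rightarrow> pser" where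
  "H_e e s = ps_scalar (1 / 2) * (ps_sqrtC + ps_scalar e * ps_H - ps_scalar (s * e))"

definition relation_series :: "nat \<Rightarrow> complex \<Rightarrow> pser" where
  "relation_series g s =
    (\<Prod>e\<in>{1, -1}. ps_quot
       (ps_quot (QT_num g (H_e e s)) (log_QT g (H_e e s)))
       (ps_quot (QT_den g (H_e e s)) (log_QT g (H_e e s))))"

definition psi_series :: "nat \<Rightarrow> pser" where
  "psi_series g =
    (\<Prod>e\<in>{1, -1}. ps_quot
       (ps_quot (QT_num g (H_e e 1)) (log_QT g (H_e e 1) * H_e e 1))
       (ps_quot (QT_den g (H_e e 1)) (log_QT g (H_e e 1))))"

text \<open>Substitution of elements \<open>H\<close> and \<open>C\<close> of a \<open>\<complex>\<close>-algebra with structure map \<open>\<eta>\<close> into a polynomial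
  that is even in \<open>\<surd>C\<close>: \<open>H\<^sup>i (\<surd>C)\<^bsup>2j\<^esup>\<close> becomes \<open>H\<^sup>i C\<^sup>j\<close>. Where \<open>H\<close> and \<open>C\<close> do not commute
  (in the free algebra) this fixes an order of the factors; modulo the relation \<open>[C,H] = 0\<close> the order
  is irrelevant. Odd powers of \<open>\<surd>C\<close> do not occur in the series to which this is applied.\<close>

definition subst_HC :: "(complex \<Rightarrow> 'a :: ring_1) \<Rightarrow> 'a \<Rightarrow> 'a \<Rightarrow> complex poly poly \<Rightarrow> 'a" where
  "subst_HC \<eta> H C p =
    (\<Sum>j\<le>degree p. \<Sum>i\<le>degree (Polynomial.coeff p (2 * j)).
       \<eta> (Polynomial.coeff (Polynomial.coeff p (2 * j)) i) * H ^ i * C ^ j)"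


section \<open>The algebra \<open>U\<^bsub>h,h'\<^esub>(sl\<^sub>2, g)\<close>\<close>

datatype U_gen = GXp | GXm | GH | GC

type_synonym U_free = "U_gen free_algebra fps fps"

definition U_free_gen :: "U_gen \<Rightarrow> U_free" where
  "U_free_gen x = hh_const (free_gen x)"

definition U_relations :: "nat \<Rightarrow> U_free set" where
  "U_relations g =
    (let Xp = U_free_gen GXp; Xm = U_free_gen GXm; H = U_free_gen GH; C = U_free_gen GC;
         ev = hh_map (subst_HC free_scalar (free_gen GH) (free_gen GC)) in
      {C * Xp - Xp * C, C * Xm - Xm * C, C * H - H * C,
       H * Xp - Xp * H - 2 * Xp,
       H * Xm - Xm * H + 2 * Xm,
       Xp * Xm - ev (relation_series g 1),
       Xm * Xp - ev (relation_series g (-1))})"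

definition U_ideal :: "nat \<Rightarrow> U_free set" where
  "U_ideal g = hh_closure (genideal ring_of_type_algebra (U_relations g))"

definition U_hh :: "nat \<Rightarrow> (complex fps fps, U_free set) module" where
  "U_hh g = quotient_algebra (hh_algebra free_scalar) (U_ideal g)"

definition U_hh_gen :: "nat \<Rightarrow> U_gen \<Rightarrow> U_free set" where
  "U_hh_gen g x = U_ideal g +>\<^bsub>hh_algebra free_scalar\<^esub> U_free_gen x"

definition U_sl2_hh :: "(complex fps fps, U_sl2 fps fps) module" where
  "U_sl2_hh = hh_algebra sl2_scalar"

lemma ideal_U_ideal: "ideal (U_ideal g) ring_of_type_algebra"
  unfolding U_ideal_def
  by (intro ideal_hh_closure ring.genideal_ideal[OF ring_ring_of_type_algebra]) simp

end

theory Submission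
  imports Defs
begin

text \<open>Write \<open>L = h + h' {x}\<^sub>Q\<close>. The quotient that belongs to \<open>x = H\<^sub>e\<^sup>\<plusminus>\<close> in the defining relations of the
  deformed algebra is \<open>sinh(L x) / sinh(L) = x G(x)\<close>, where \<open>G(x) = sinh(L x) / (x sinh(L))\<close> is a quotient
  of two units and has constant term \<open>1\<close> (\<open>relation_factor\<close>, \<open>QT_ratio_nth_0\<close>). Since
  \<open>H\<^sub>1\<^sup>\<plusminus> H\<^sub>-\<^sub>1\<^sup>\<plusminus> = (C - (H \<minusplus> 1)\<^sup>2) / 4\<close>, which is the value of \<open>X\<^sup>\<plusminus> X\<^sup>\<minusplus>\<close> in \<open>U(sl\<^sub>2)\<close>, the deformed
  relations arise from the classical ones through multiplication of the right-hand sides by \<open>G(H\<^sub>1\<^sup>\<plusminus>) G(H\<^sub>-\<^sub>1\<^sup>\<plusminus>)\<close> (\<open>relation_series_eq\<close>).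

  The formula for \<open>\<psi>\<close> multiplies \<open>X\<^sup>+\<close> by \<open>F = G(H\<^sub>1\<^sup>+) G(H\<^sub>-\<^sub>1\<^sup>+)\<close>, so that the relation for \<open>X\<^sup>+ X\<^sup>-\<close> is respected.
  In \<open>X\<^sup>- F X\<^sup>+\<close> the element \<open>X\<^sup>-\<close> is moved past \<open>F\<close>, which replaces \<open>H\<close> by \<open>H + 2\<close> (\<open>sl2_Xm_ev\<close>); as this
  turns \<open>H\<^sub>e\<^sup>+\<close> into \<open>H\<^sub>e\<^sup>-\<close> (\<open>ratio_pair_shift\<close>), the relation for \<open>X\<^sup>- X\<^sup>+\<close> is respected too
  (\<open>psi_map_relations\<close>). Thus there is a continuous homomorphism \<open>\<Psi>\<close> from \<open>\<complex>\<langle>X\<rangle>[[h,h']]\<close> to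
  \<open>U(sl\<^sub>2)[[h,h']]\<close> that kills the closure of the ideal \<open>I\<close> generated by the relations.

  Modulo \<open>(h,h')\<close>, the relations say that \<open>C\<close> is the Casimir element and that \<open>X\<^sup>+, X\<^sup>-, H\<close> satisfy the relations
  of \<open>U(sl\<^sub>2)\<close>, hence \<open>\<Psi>\<close> induces an isomorphism there. This lifts to all orders. Surjectivity
  follows by successive approximation (\<open>surj_fps_lift\<close>). For injectivity, an element of the kernel
  is congruent modulo \<open>(h,h')\<close> to an element of \<open>I\<close>; as \<open>h, h'\<close> is a regular sequence in the target and \<open>\<Psi>\<close>
  is surjective, the difference lies in \<open>h ker \<Psi> + h' ker \<Psi>\<close>, and iteration gives
  \<open>ker \<Psi> \<subseteq> I + (h,h')\<^sup>n\<close> for all \<open>n\<close> (\<open>kernel_le_hh_closure\<close>).\<close>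

section \<open>Homomorphisms of unital rings and free algebras\<close>

locale unital_hom =
  fixes f :: "'a :: ring_1 \<Rightarrow> 'b :: ring_1"
  assumes one: "f 1 = 1"
    and add: "f (x + y) = f x + f y"
    and mult: "f (x * y) = f x * f y"
begin

lemma zero: "f 0 = 0"
  using add[of 0 0] by simp

lemma uminus: "f (- x) = - f x"
  using add[of x "- x"] zero by (simp add: eq_neg_iff_add_eq_0 add.commute)

lemma diff: "f (x - y) = f x - f y"
  using add[of x "- y"] uminus[of y] by simp

lemma power: "f (x ^ n) = f x ^ n"
  by (induction n) (simp_all add: one mult)

lemma sum: "f (sum u A) = (\<Sum>i\<in>A. f (u i))"
  by (induction A rule: infinite_finite_induct) (simp_all add: zero add)

lemma of_nat: "f (of_nat n) = of_nat n"
  by (induction n) (simp_all add: zero one add)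

lemma numeral: "f (numeral n) = numeral n"
  using of_nat[of "Num.numeral n"] by simp

lemmas ring_ops = zero one add mult uminus diff power numeral

lemma genideal_le_kernel:
  assumes "\<And>r. r \<in> R \<Longrightarrow> f r = 0" and "x \<in> genideal ring_of_type_algebra R"
  shows "f x = 0"
proof -
  have "ideal {x. f x = 0} ring_of_type_algebra"
    by (rule ideal_of_type_algebraI) (simp_all add: ring_ops)
  then have "genideal ring_of_type_algebra R \<subseteq> {x. f x = 0}"
    using assms(1) by (intro ring.genideal_minimal[OF ring_ring_of_type_algebra]) auto
  then show ?thesis using assms(2) by auto
qed

end

lemma unital_hom_prod:
  fixes f :: "'a :: comm_ring_1 \<Rightarrow> 'b :: comm_ring_1"
  assumes "unital_hom f"
  shows "f (prod u A) = (\<Prod>i\<in>A. f (u i))"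
  by (induction A rule: infinite_finite_induct)
    (simp_all add: unital_hom.one[OF assms] unital_hom.mult[OF assms])

lemma genideal_subset:
  fixes I :: "'a :: ring_1 set"
  assumes "ideal I ring_of_type_algebra" "R \<subseteq> I"
  shows "genideal ring_of_type_algebra R \<subseteq> I"
  using assms by (intro ring.genideal_minimal[OF ring_ring_of_type_algebra])

lemma genideal_incl:
  fixes R :: "'a :: ring_1 set"
  shows "R \<subseteq> genideal ring_of_type_algebra R"
  by (intro ring.genideal_self[OF ring_ring_of_type_algebra]) simp

lemma ideal_genideal:
  fixes R :: "'a :: ring_1 set"
  shows "ideal (genideal ring_of_type_algebra R) ring_of_type_algebra"
  by (rule ring.genideal_ideal[OF ring_ring_of_type_algebra]) simp

lemma update_eq_add_single:
  assumes "a \<notin> Poly_Mapping.keys f"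
  shows "Poly_Mapping.update a b f = f + Poly_Mapping.single a b"
  using assms by (intro poly_mapping_eqI)
    (auto simp: lookup_update lookup_add lookup_single when_def in_keys_iff)

text \<open>The scalars and the generators generate the algebra, so that closure under sums and products
  suffices; identities between homomorphisms, centrality of the scalars and normal forms modulo an ideal
  are all obtained in this way.\<close>

lemma free_algebra_induct [case_names scalar gen add mult]:
  fixes x :: "'x free_algebra"
  assumes scalar: "\<And>c. P (free_scalar c)" and gen: "\<And>a. P (free_gen a)"
    and add: "\<And>x y. P x \<Longrightarrow> P y \<Longrightarrow> P (x + y)" and mult: "\<And>x y. P x \<Longrightarrow> P y \<Longrightarrow> P (x * y)"
  shows "P x"
proof -
  have word: "P (Poly_Mapping.single (Word w) 1)" for w :: "'x list"
  proof (induction w)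
    case Nil
    then show ?case using scalar[of 1] by (simp add: free_scalar_def zero_free_monoid_def)
  next
    case (Cons a w)
    have "Poly_Mapping.single (Word (a # w)) 1 = free_gen a * Poly_Mapping.single (Word w) (1::complex)"
      by (simp add: free_gen_def mult_single plus_free_monoid_def)
    then show ?case using mult[OF gen[of a] Cons] by simp
  qed
  have mon: "P (Poly_Mapping.single w c)" for w :: "'x free_monoid" and c
  proof -
    have "Poly_Mapping.single w c = free_scalar c * Poly_Mapping.single (Word (letters w)) 1"
      by (simp add: free_scalar_def mult_single)
    then show ?thesis using mult[OF scalar word] by metis
  qed
  show ?thesis
  proof (induction x rule: update_induct)
    case const
    then show ?case using scalar[of 0] by (simp add: free_scalar_def)
  next
    case (update f a b)
    then show ?case using add[OF update(3) mon] by (simp add: update_eq_add_single)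
  qed
qed

interpretation free_scalar: unital_hom "free_scalar :: complex \<Rightarrow> 'x free_algebra"
  by unfold_locales (simp_all add: free_scalar_def single_add mult_single)

lemma free_scalar_commute: "free_scalar c * x = x * free_scalar c"
proof (induction x rule: free_algebra_induct)
  case (scalar d)
  show ?case by (simp flip: free_scalar.mult add: mult.commute)
next
  case (gen a)
  show ?case by (simp add: free_scalar_def free_gen_def mult_single)
next
  case (mult x y)
  then show ?case by (metis mult.assoc)
qed (simp add: algebra_simps)

definition free_hom :: "(complex \<Rightarrow> 'a :: ring_1) \<Rightarrow> ('x \<Rightarrow> 'a) \<Rightarrow> 'x free_algebra \<Rightarrow> 'a" where
  "free_hom \<eta> \<iota> x =
    (\<Sum>w\<in>Poly_Mapping.keys x. \<eta> (Poly_Mapping.lookup x w) * prod_list (map \<iota> (letters w)))"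

locale central_scalars = \<eta>: unital_hom \<eta> for \<eta> :: "complex \<Rightarrow> 'a :: ring_1" +
  assumes central: "\<eta> c * x = x * \<eta> c"
begin

lemma free_hom_superset:
  assumes "finite A" "Poly_Mapping.keys x \<subseteq> A"
  shows "free_hom \<eta> \<iota> x =
    (\<Sum>w\<in>A. \<eta> (Poly_Mapping.lookup x w) * prod_list (map \<iota> (letters w)))"
  unfolding free_hom_def using assms
  by (intro sum.mono_neutral_left) (auto simp: in_keys_iff \<eta>.zero)

lemma free_hom_add: "free_hom \<eta> \<iota> (x + y) = free_hom \<eta> \<iota> x + free_hom \<eta> \<iota> y"
proof -
  let ?A = "Poly_Mapping.keys x \<union> Poly_Mapping.keys y"
  have "Poly_Mapping.keys (x + y) \<subseteq> ?A" by (rule Poly_Mapping.keys_add)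
  then show ?thesis
    by (simp add: free_hom_superset[of ?A] lookup_add \<eta>.add distrib_right sum.distrib)
qed

lemma free_hom_single:
  "free_hom \<eta> \<iota> (Poly_Mapping.single w c) = \<eta> c * prod_list (map \<iota> (letters w))"
  by (simp add: free_hom_superset[of "{w}"])

lemma free_hom_scalar: "free_hom \<eta> \<iota> (free_scalar c) = \<eta> c"
  by (simp add: free_scalar_def free_hom_single zero_free_monoid_def)

lemma free_hom_gen: "free_hom \<eta> \<iota> (free_gen a) = \<iota> a"
  by (simp add: free_gen_def free_hom_single \<eta>.one)

lemma free_hom_mult_single:
  "free_hom \<eta> \<iota> (Poly_Mapping.single v c * x) = free_hom \<eta> \<iota> (Poly_Mapping.single v c) * free_hom \<eta> \<iota> x"
proof (induction x rule: update_induct)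
  case const
  then show ?case by (simp add: free_hom_def)
next
  case (update f a b)
  note eq = update_eq_add_single[OF update(1)]
  have "free_hom \<eta> \<iota> (Poly_Mapping.single v c * Poly_Mapping.single a b) =
      \<eta> c * \<eta> b * (prod_list (map \<iota> (letters v)) * prod_list (map \<iota> (letters a)))"
    by (simp add: mult_single free_hom_single \<eta>.mult plus_free_monoid_def)
  also have "\<dots> = free_hom \<eta> \<iota> (Poly_Mapping.single v c) * free_hom \<eta> \<iota> (Poly_Mapping.single a b)"
    unfolding free_hom_single by (metis central mult.assoc)
  finally show ?case
    unfolding eq by (simp add: distrib_left free_hom_add update)
qed

lemma unital_hom_free_hom: "unital_hom (free_hom \<eta> \<iota>)"
proof
  show "free_hom \<eta> \<iota> 1 = 1"
    using free_hom_scalar[of \<iota> 1] by (simp add: free_scalar.one \<eta>.one)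
  show "free_hom \<eta> \<iota> (x + y) = free_hom \<eta> \<iota> x + free_hom \<eta> \<iota> y" for x y
    by (rule free_hom_add)
  show "free_hom \<eta> \<iota> (x * y) = free_hom \<eta> \<iota> x * free_hom \<eta> \<iota> y" for x y
  proof (induction x rule: update_induct)
    case const
    then show ?case by (simp add: free_hom_def)
  next
    case (update f a b)
    note eq = update_eq_add_single[OF update(1)]
    show ?case
      unfolding eq by (simp add: distrib_right free_hom_add free_hom_mult_single update)
  qed
qed

end

interpretation free_scalar: central_scalars "free_scalar :: complex \<Rightarrow> 'x free_algebra"
  by unfold_locales (rule free_scalar_commute)

lemma free_algebra_hom_eqI:
  assumes "unital_hom f" "unital_hom g"
    and "\<And>c. f (free_scalar c) = g (free_scalar c)" "\<And>a. f (free_gen a) = g (free_gen a)"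
  shows "f x = g x"
  by (induction x rule: free_algebra_induct)
    (simp_all add: assms(3,4) unital_hom.add[OF assms(1)] unital_hom.add[OF assms(2)]
      unital_hom.mult[OF assms(1)] unital_hom.mult[OF assms(2)])

section \<open>Power series extensions of homomorphisms\<close>

text \<open>The \<open>t\<close>-adically continuous extension of \<open>\<phi> : V \<rightarrow> W[[t]]\<close> to \<open>V[[t]]\<close>, that is
  \<open>\<Sum>\<^sub>i a\<^sub>i t\<^sup>i \<mapsto> \<Sum>\<^sub>i \<phi>(a\<^sub>i) t\<^sup>i\<close>.\<close>

definition fps_lift :: "('a :: ring_1 \<Rightarrow> 'b :: ring_1 fps) \<Rightarrow> 'a fps \<Rightarrow> 'b fps" where
  "fps_lift \<phi> f = Abs_fps (\<lambda>n. \<Sum>i\<le>n. \<phi> (f $ i) $ (n - i))"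

lemma fps_lift_nth: "fps_lift \<phi> f $ n = (\<Sum>i\<le>n. \<phi> (f $ i) $ (n - i))"
  by (simp add: fps_lift_def)

lemma fps_lift_nth_0: "fps_lift \<phi> f $ 0 = \<phi> (f $ 0) $ 0"
  by (simp add: fps_lift_nth)

lemma fps_mult_nth_cong:
  fixes f :: "'a :: ring_1 fps"
  assumes "\<And>i. i \<le> n \<Longrightarrow> f $ i = f' $ i" "\<And>i. i \<le> n \<Longrightarrow> g $ i = g' $ i"
  shows "(f * g) $ n = (f' * g') $ n"
  unfolding fps_mult_nth using assms by (intro sum.cong) auto

lemma fps_lift_nth_trunc:
  assumes "n \<le> N"
  shows "fps_lift \<phi> f $ n = (\<Sum>i\<le>N. fps_X ^ i * \<phi> (f $ i)) $ n"
proof -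
  have "(\<Sum>i\<le>N. fps_X ^ i * \<phi> (f $ i)) $ n = (\<Sum>i\<le>N. if i \<le> n then \<phi> (f $ i) $ (n - i) else 0)"
    unfolding fps_sum_nth by (intro sum.cong) (auto simp: fps_X_power_mult_nth)
  also have "\<dots> = (\<Sum>i\<in>{..n}. \<phi> (f $ i) $ (n - i))"
    using assms by (intro sum.mono_neutral_cong_right) auto
  finally show ?thesis by (simp add: fps_lift_nth)
qed

lemma fps_X_power_commute: "f * fps_X ^ n = fps_X ^ n * (f :: 'a :: ring_1 fps)"
  by (induction n) (simp_all, metis fps_mult_fps_X_commute mult.assoc)

text \<open>Collecting the terms by the degree \<open>m = i + j\<close> of the arguments shows that, for a multiplicative
  \<open>\<phi> = \<psi>\<close>, the product of the extensions is the extension of the Cauchy product. The two maps are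
  kept apart because the coefficients in \<open>h'\<close> of a homomorphism into \<open>V[[h]][[h']]\<close> are not
  homomorphisms: they only satisfy \<open>\<phi>\<^sub>b(xy) = \<Sum>\<^sub>c \<phi>\<^sub>c(x) \<phi>\<^sub>b\<^sub>-\<^sub>c(y)\<close>.\<close>

lemma fps_lift_mult_nth:
  fixes \<phi> :: "'a :: ring_1 \<Rightarrow> 'c :: ring_1 fps" and \<psi> :: "'b :: ring_1 \<Rightarrow> 'c fps"
  shows "(fps_lift \<phi> f * fps_lift \<psi> g) $ n =
    (\<Sum>m\<le>n. \<Sum>i\<le>m. (\<phi> (f $ i) * \<psi> (g $ (m - i))) $ (n - m))"
proof -
  define c where "c i j = (\<phi> (f $ i) * \<psi> (g $ j)) $ (n - (i + j))" for i j
  \<comment> \<open>The variable is central although the coefficients need not commute.\<close>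
  have comm: "fps_X ^ i * x * (fps_X ^ j * y) = fps_X ^ (i + j) * (x * y)"
    for i j and x y :: "'c fps"
  proof -
    have "x * (fps_X ^ j * y) = fps_X ^ j * (x * y)"
      by (simp add: fps_X_power_commute[of x] flip: mult.assoc)
    then show ?thesis by (simp add: power_add mult.assoc)
  qed
  have "(fps_lift \<phi> f * fps_lift \<psi> g) $ n =
      ((\<Sum>i\<le>n. fps_X ^ i * \<phi> (f $ i)) * (\<Sum>j\<le>n. fps_X ^ j * \<psi> (g $ j))) $ n"
    by (intro fps_mult_nth_cong fps_lift_nth_trunc)
  also have "\<dots> = (\<Sum>i\<le>n. \<Sum>j\<le>n. if i + j \<le> n then c i j else 0)"
    unfolding sum_product fps_sum_nth comm
    by (intro sum.cong) (auto simp: fps_X_power_mult_nth c_def)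
  also have "\<dots> = (\<Sum>(i, j)\<in>{(i, j). i + j \<le> n}. c i j)"
    unfolding sum.cartesian_product by (rule sum.mono_neutral_cong_right) (auto split: if_splits)
  also have "\<dots> = (\<Sum>m\<le>n. \<Sum>i\<le>m. c i (m - i))"
    by (rule sum.triangle_reindex_eq)
  also have "\<dots> = (\<Sum>m\<le>n. \<Sum>i\<le>m. (\<phi> (f $ i) * \<psi> (g $ (m - i))) $ (n - m))"
    by (intro sum.cong) (simp_all add: c_def)
  finally show ?thesis .
qed

lemma fps_lift_of_const:
  assumes "\<And>i. \<phi> (f $ i) = fps_const (u $ i)"
  shows "fps_lift \<phi> f = u"
proof (rule fps_ext)
  fix n
  have "(\<Sum>i\<le>n. \<phi> (f $ i) $ (n - i)) = (\<Sum>i\<le>n. if i = n then u $ i else 0)"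
    by (intro sum.cong) (auto simp: assms)
  then show "fps_lift \<phi> f $ n = u $ n"
    by (simp add: fps_lift_nth)
qed

lemma fps_lift_const:
  assumes "\<phi> 0 = 0"
  shows "fps_lift \<phi> (fps_const a) = \<phi> a"
proof (rule fps_ext)
  fix n
  have "(\<Sum>i\<le>n. \<phi> (fps_const a $ i) $ (n - i)) = (\<Sum>i\<in>{0::nat}. \<phi> a $ n)"
    by (intro sum.mono_neutral_cong_right) (auto simp: assms)
  then show "fps_lift \<phi> (fps_const a) $ n = \<phi> a $ n"
    by (simp add: fps_lift_nth)
qed

lemma fps_lift_X:
  assumes "\<phi> 0 = 0" "\<phi> 1 = 1"
  shows "fps_lift \<phi> fps_X = fps_X"
  by (rule fps_lift_of_const) (use assms in \<open>auto simp: fps_X_def\<close>)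

lemma unital_hom_fps_lift:
  assumes "unital_hom \<phi>"
  shows "unital_hom (fps_lift \<phi>)"
proof -
  interpret unital_hom \<phi> by fact
  show ?thesis
  proof
    show "fps_lift \<phi> 1 = 1"
      using fps_lift_const[of \<phi>, OF zero, of 1] one by simp
    show "fps_lift \<phi> (x + y) = fps_lift \<phi> x + fps_lift \<phi> y" for x y
      by (rule fps_ext) (simp add: fps_lift_nth add sum.distrib)
    show "fps_lift \<phi> (x * y) = fps_lift \<phi> x * fps_lift \<phi> y" for x y
      by (rule fps_ext, unfold fps_lift_mult_nth)
        (simp add: fps_lift_nth fps_mult_nth sum mult fps_sum_nth atMost_atLeast0)
  qed
qed

text \<open>A series in the target is matched coefficient by coefficient: once the first \<open>n\<close> coefficients of
  a preimage are known, the next one has only to correct the error by means of the section.\<close>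

fun fps_lift_section ::
    "('a :: ring_1 \<Rightarrow> 'b :: ring_1 fps) \<Rightarrow> ('b \<Rightarrow> 'a) \<Rightarrow> 'b fps \<Rightarrow> nat \<Rightarrow> 'a" where
  "fps_lift_section \<phi> \<sigma> f n =
    \<sigma> (f $ n - (\<Sum>i\<leftarrow>[0..<n]. \<phi> (fps_lift_section \<phi> \<sigma> f i) $ (n - i)))"

declare fps_lift_section.simps [simp del]

text \<open>Applied twice, for \<open>h\<close> and then for \<open>h'\<close>, this reduces surjectivity in \<open>V[[h,h']]\<close> to the
  constant terms.\<close>

lemma surj_fps_lift:
  assumes "surj (\<lambda>x. \<phi> x $ 0)"
  shows "surj (fps_lift \<phi>)"
proof -
  define \<sigma> where "\<sigma> = inv_into UNIV (\<lambda>x. \<phi> x $ 0)"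
  have \<sigma>: "\<phi> (\<sigma> y) $ 0 = y" for y
    unfolding \<sigma>_def by (rule surj_f_inv_f[OF assms])
  have "fps_lift \<phi> (Abs_fps (fps_lift_section \<phi> \<sigma> f)) = f" for f
  proof (rule fps_ext)
    fix n
    let ?a = "fps_lift_section \<phi> \<sigma> f"
    have "fps_lift \<phi> (Abs_fps ?a) $ n = (\<Sum>i<n. \<phi> (?a i) $ (n - i)) + \<phi> (?a n) $ 0"
      by (simp add: fps_lift_nth flip: lessThan_Suc_atMost)
    also have "\<phi> (?a n) $ 0 = f $ n - (\<Sum>i<n. \<phi> (?a i) $ (n - i))"
      by (subst fps_lift_section.simps) (simp add: \<sigma> interv_sum_list_conv_sum_set_nat atLeast0LessThan)
    finally show "fps_lift \<phi> (Abs_fps ?a) $ n = f $ n" by simp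
  qed
  then show ?thesis by (rule surjI)
qed

text \<open>Extension along \<open>h\<close> of a map into \<open>V[[h]][[h']]\<close>, done separately for each coefficient in \<open>h'\<close>.\<close>

definition fps_lift_inner :: "('a :: ring_1 \<Rightarrow> 'b :: ring_1 fps fps) \<Rightarrow> 'a fps \<Rightarrow> 'b fps fps" where
  "fps_lift_inner \<phi> f = Abs_fps (\<lambda>b. fps_lift (\<lambda>x. \<phi> x $ b) f)"

definition hh_lift :: "('a :: ring_1 \<Rightarrow> 'b :: ring_1 fps fps) \<Rightarrow> 'a fps fps \<Rightarrow> 'b fps fps" where
  "hh_lift \<phi> = fps_lift (fps_lift_inner \<phi>)"

lemma fps_lift_inner_const:
  assumes "\<phi> 0 = 0"
  shows "fps_lift_inner \<phi> (fps_const a) = \<phi> a"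
  by (rule fps_ext) (simp add: fps_lift_inner_def fps_lift_const assms)

lemma unital_hom_fps_lift_inner:
  assumes "unital_hom \<phi>"
  shows "unital_hom (fps_lift_inner \<phi>)"
proof -
  interpret unital_hom \<phi> by fact
  show ?thesis
  proof
    show "fps_lift_inner \<phi> 1 = 1"
      using fps_lift_inner_const[of \<phi>, OF zero, of 1] one by simp
    show "fps_lift_inner \<phi> (x + y) = fps_lift_inner \<phi> x + fps_lift_inner \<phi> y" for x y
      by (intro fps_ext) (simp add: fps_lift_inner_def fps_lift_nth add sum.distrib)
    show "fps_lift_inner \<phi> (x * y) = fps_lift_inner \<phi> x * fps_lift_inner \<phi> y" for x y
    proof (intro fps_ext)
      fix b n
      have "fps_lift_inner \<phi> (x * y) $ b $ n =
          (\<Sum>m\<le>n. \<Sum>i\<le>m. \<Sum>c\<le>b. (\<phi> (x $ i) $ c * \<phi> (y $ (m - i)) $ (b - c)) $ (n - m))"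
        by (simp add: fps_lift_inner_def fps_lift_nth fps_mult_nth[of x] sum mult fps_sum_nth
            fps_mult_nth[of "\<phi> _"] atMost_atLeast0)
      also have "\<dots> = (\<Sum>m\<le>n. \<Sum>c\<le>b. \<Sum>i\<le>m. (\<phi> (x $ i) $ c * \<phi> (y $ (m - i)) $ (b - c)) $ (n - m))"
        by (intro sum.cong refl sum.swap)
      also have "\<dots> = (\<Sum>c\<le>b. \<Sum>m\<le>n. \<Sum>i\<le>m. (\<phi> (x $ i) $ c * \<phi> (y $ (m - i)) $ (b - c)) $ (n - m))"
        by (rule sum.swap)
      also have "\<dots> = (\<Sum>c\<le>b. (fps_lift (\<lambda>x. \<phi> x $ c) x * fps_lift (\<lambda>x. \<phi> x $ (b - c)) y) $ n)"
        unfolding fps_lift_mult_nth ..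
      also have "\<dots> = (fps_lift_inner \<phi> x * fps_lift_inner \<phi> y) $ b $ n"
        unfolding fps_mult_nth[of "fps_lift_inner \<phi> x"] fps_sum_nth atMost_atLeast0
        by (simp add: fps_lift_inner_def)
      finally show "fps_lift_inner \<phi> (x * y) $ b $ n = (fps_lift_inner \<phi> x * fps_lift_inner \<phi> y) $ b $ n" .
    qed
  qed
qed

lemma unital_hom_hh_lift: "unital_hom \<phi> \<Longrightarrow> unital_hom (hh_lift \<phi>)"
  unfolding hh_lift_def by (intro unital_hom_fps_lift unital_hom_fps_lift_inner)

lemma hh_lift_const:
  assumes "unital_hom \<phi>"
  shows "hh_lift \<phi> (hh_const a) = \<phi> a"
  unfolding hh_lift_def hh_const_def
  by (simp add: fps_lift_const unital_hom.zero[OF assms]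
      unital_hom.zero[OF unital_hom_fps_lift_inner[OF assms]] fps_lift_inner_const)

lemma hh_lift_nth_0: "hh_lift \<phi> f $ 0 $ 0 = \<phi> (f $ 0 $ 0) $ 0 $ 0"
  by (simp add: hh_lift_def fps_lift_nth_0 fps_lift_inner_def)

lemma hh_lift_scalar_series:
  assumes "unital_hom \<phi>" "\<And>z. \<phi> (\<kappa> z) = hh_const (\<kappa>' z)"
  shows "hh_lift \<phi> (hh_map \<kappa> c) = hh_map \<kappa>' c"
  unfolding hh_lift_def
proof (rule fps_lift_of_const)
  fix i
  show "fps_lift_inner \<phi> (hh_map \<kappa> c $ i) = fps_const (hh_map \<kappa>' c $ i)"
  proof (rule fps_ext)
    fix b
    show "fps_lift_inner \<phi> (hh_map \<kappa> c $ i) $ b = fps_const (hh_map \<kappa>' c $ i) $ b"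
      unfolding fps_lift_inner_def fps_nth_Abs_fps
      by (rule fps_lift_of_const) (simp add: hh_map_def assms(2) hh_const_def)
  qed
qed

lemma hh_lift_h:
  assumes "unital_hom \<phi>"
  shows "hh_lift \<phi> hh_h = hh_h"
proof -
  interpret unital_hom \<phi> by fact
  interpret inner: unital_hom "fps_lift_inner \<phi>" by (rule unital_hom_fps_lift_inner[OF assms])
  have "fps_lift_inner \<phi> fps_X = fps_const fps_X"
  proof (rule fps_ext)
    fix b
    show "fps_lift_inner \<phi> fps_X $ b = fps_const fps_X $ b"
      unfolding fps_lift_inner_def fps_nth_Abs_fps
      by (rule fps_lift_of_const) (simp add: fps_X_def zero one)
  qed
  then show ?thesis
    by (simp add: hh_lift_def hh_h_def fps_lift_const inner.zero)
qed

lemma hh_lift_h':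
  assumes "unital_hom \<phi>"
  shows "hh_lift \<phi> hh_h' = hh_h'"
proof -
  interpret inner: unital_hom "fps_lift_inner \<phi>" by (rule unital_hom_fps_lift_inner[OF assms])
  show ?thesis
    by (simp add: hh_lift_def hh_h'_def fps_lift_X inner.zero inner.one)
qed

lemma surj_hh_lift:
  assumes "surj (\<lambda>x. \<phi> x $ 0 $ 0)"
  shows "surj (hh_lift \<phi>)"
proof -
  have "surj (fps_lift (\<lambda>x. \<phi> x $ 0))" by (rule surj_fps_lift[OF assms])
  then show ?thesis
    unfolding hh_lift_def by (intro surj_fps_lift) (simp add: fps_lift_inner_def)
qed

section \<open>The \<open>(h,h')\<close>-adic filtration\<close>

lemma hh_h_central: "hh_h * f = f * (hh_h :: 'a :: ring_1 fps fps)"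
proof (rule fps_ext)
  fix n
  show "(hh_h * f) $ n = (f * hh_h) $ n"
    by (simp add: hh_h_def fps_mult_fps_X_commute)
qed

lemma hh_h'_central: "hh_h' * f = f * (hh_h' :: 'a :: ring_1 fps fps)"
  by (simp add: hh_h'_def fps_mult_fps_X_commute)

lemma unital_hom_hh_const: "unital_hom hh_const"
  by unfold_locales (simp_all add: hh_const_def fps_const_mult)

lemma unital_hom_hh_map:
  assumes "unital_hom \<phi>"
  shows "unital_hom (hh_map \<phi>)"
proof -
  interpret unital_hom \<phi> by fact
  show ?thesis
  proof
    show "hh_map \<phi> 1 = 1"
      by (intro fps_ext) (simp add: hh_map_def zero one)
    show "hh_map \<phi> (x + y) = hh_map \<phi> x + hh_map \<phi> y" for x y
      by (intro fps_ext) (simp add: hh_map_def add)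
    show "hh_map \<phi> (x * y) = hh_map \<phi> x * hh_map \<phi> y" for x y
      by (intro fps_ext) (simp add: hh_map_def fps_mult_nth fps_sum_nth sum mult)
  qed
qed

text \<open>The monomials that contain \<open>h'\<close> are put into \<open>v\<close>, the pure powers of \<open>h\<close> into \<open>u\<close>.\<close>

lemma hh_decompose:
  fixes f :: "'a :: ring_1 fps fps"
  assumes "f $ 0 $ 0 = 0"
  obtains u v where "f = hh_h * u + hh_h' * v"
proof
  show "f = hh_h * fps_const (fps_shift 1 (f $ 0)) + hh_h' * fps_shift 1 f"
  proof (intro fps_ext)
    fix b a
    show "f $ b $ a = (hh_h * fps_const (fps_shift 1 (f $ 0)) + hh_h' * fps_shift 1 f) $ b $ a"
      using assms by (cases b; cases a) (auto simp: hh_h_def hh_h'_def)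
  qed
qed

text \<open>The sequence \<open>h, h'\<close> is regular: its only relations are multiples of \<open>h' h - h h' = 0\<close>.\<close>

lemma hh_syzygy:
  fixes u v :: "'a :: ring_1 fps fps"
  assumes "hh_h * u + hh_h' * v = 0"
  obtains w where "u = hh_h' * w" "v = - (hh_h * w)"
proof
  have X: "fps_X * f = 0 \<longleftrightarrow> f = 0" for f :: "'b :: ring_1 fps"
  proof
    assume "fps_X * f = 0"
    then have "(fps_X * f) $ Suc n = 0" for n by simp
    then show "f = 0" by (intro fps_ext) simp
  qed simp
  have "(hh_h * u + hh_h' * v) $ 0 = 0" using assms by simp
  then have "fps_X * (u $ 0) = 0" by (simp add: hh_h_def hh_h'_def)
  then have "u $ 0 = 0" by (simp add: X)
  then show u: "u = hh_h' * fps_shift 1 u"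
    by (intro fps_ext) (auto simp: hh_h'_def)
  have "hh_h' * (hh_h * fps_shift 1 u + v) = hh_h * u + hh_h' * v"
    by (subst (2) u) (simp add: distrib_left, metis hh_h_central mult.assoc)
  then have "hh_h * fps_shift 1 u + v = 0"
    using assms by (simp add: hh_h'_def X)
  then show "v = - (hh_h * fps_shift 1 u)" by (simp add: eq_neg_iff_add_eq_0 add.commute)
qed

lemmas hh_powerD = ideal_of_type_algebraD[OF ideal_hh_power]

lemma hh_power_gen: "i + j = n \<Longrightarrow> hh_h ^ i * hh_h' ^ j \<in> hh_power n"
  unfolding hh_power_def using genideal_incl by fastforce

lemma hh_power_0: "hh_power 0 = (UNIV :: 'a :: ring_1 fps fps set)"
proof -
  have "(1 :: 'a fps fps) \<in> hh_power 0" using hh_power_gen[of 0 0 0] by simp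
  then have "x * 1 \<in> hh_power 0" for x :: "'a fps fps" by (rule hh_powerD)
  then show ?thesis by auto
qed

lemma central_mult_hh_power:
  fixes z :: "'a :: ring_1 fps fps"
  assumes z: "\<And>f. z * f = f * z"
    and gen: "\<And>i j. i + j = n \<Longrightarrow> z * (hh_h ^ i * hh_h' ^ j) \<in> hh_power m"
    and "f \<in> hh_power n"
  shows "z * f \<in> hh_power m"
proof -
  have "ideal {f. z * f \<in> hh_power m} ring_of_type_algebra"
  proof (rule ideal_of_type_algebraI)
    fix x y assume x: "x \<in> {f. z * f \<in> hh_power m}"
    then show "x * y \<in> {f. z * f \<in> hh_power m}"
      using hh_powerD(4)[of "z * x" m y] by (simp add: mult.assoc)
    have "z * (y * x) = y * (z * x)" using z by (metis mult.assoc)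
    then show "y * x \<in> {f. z * f \<in> hh_power m}"
      using x hh_powerD(3)[of "z * x" m y] by simp
  qed (auto simp: distrib_left hh_powerD)
  then have "hh_power n \<subseteq> {f. z * f \<in> hh_power m}"
    unfolding hh_power_def[of n] by (rule genideal_subset) (use gen in auto)
  then show ?thesis using assms(3) by auto
qed

lemma h_mult_hh_power: "f \<in> hh_power n \<Longrightarrow> hh_h * f \<in> hh_power (Suc n)"
proof (rule central_mult_hh_power[OF hh_h_central])
  fix i j assume "i + j = n"
  then show "hh_h * (hh_h ^ i * hh_h' ^ j) \<in> hh_power (Suc n)"
    using hh_power_gen[of "Suc i" j "Suc n"] by (simp add: mult.assoc)
qed

lemma h'_mult_hh_power:
  fixes f :: "'a :: ring_1 fps fps"
  shows "f \<in> hh_power n \<Longrightarrow> hh_h' * f \<in> hh_power (Suc n)"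
proof (rule central_mult_hh_power[OF hh_h'_central])
  fix i j assume "i + j = n"
  moreover have "hh_h' * (hh_h ^ i * hh_h' ^ j) = hh_h ^ i * (hh_h' ^ Suc j :: 'a fps fps)"
    by (simp add: hh_h'_central[of "hh_h ^ i"] flip: mult.assoc)
  ultimately show "hh_h' * (hh_h ^ i * hh_h' ^ j :: 'a fps fps) \<in> hh_power (Suc n)"
    using hh_power_gen[of i "Suc j" "Suc n"] by simp
qed

text \<open>A description of the powers \<open>(h,h')\<^sup>n\<close> by coefficients; one inclusion is enough to see that the
  filtration is separated.\<close>

definition hh_low_zero :: "nat \<Rightarrow> 'a :: ring_1 fps fps set" where
  "hh_low_zero n = {f. \<forall>b a. a + b < n \<longrightarrow> f $ b $ a = 0}"

lemma hh_low_zero_mult: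
  assumes "f \<in> hh_low_zero m" "g \<in> hh_low_zero n"
  shows "f * g \<in> hh_low_zero (m + n)"
proof -
  have "(f * g) $ b $ a = 0" if "a + b < m + n" for a b
    unfolding fps_mult_nth fps_sum_nth
  proof (intro sum.neutral ballI)
    fix i j assume "i \<in> {0..b}" "j \<in> {0..a}"
    then have "j + i < m \<or> (a - j) + (b - i) < n" using that by auto
    then show "f $ i $ j * g $ (b - i) $ (a - j) = 0"
      using assms by (auto simp: hh_low_zero_def)
  qed
  then show ?thesis by (simp add: hh_low_zero_def)
qed

lemma hh_low_zero_power:
  assumes "f \<in> hh_low_zero 1"
  shows "f ^ n \<in> hh_low_zero n"
proof (induction n)
  case (Suc n)
  then show ?case using hh_low_zero_mult[OF assms Suc] by simp
qed (simp add: hh_low_zero_def)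

lemma hh_power_low_zero: "hh_power n \<subseteq> (hh_low_zero n :: 'a :: ring_1 fps fps set)"
  unfolding hh_power_def
proof (rule genideal_subset)
  show "ideal (hh_low_zero n :: 'a fps fps set) ring_of_type_algebra"
  proof (rule ideal_of_type_algebraI)
    have UN: "y \<in> hh_low_zero 0" for y :: "'a fps fps" by (simp add: hh_low_zero_def)
    fix x y :: "'a fps fps" assume x: "x \<in> hh_low_zero n"
    show "x * y \<in> hh_low_zero n" using hh_low_zero_mult[OF x UN] by simp
    show "y * x \<in> hh_low_zero n" using hh_low_zero_mult[OF UN x] by simp
  qed (auto simp: hh_low_zero_def)
  have "hh_h \<in> hh_low_zero 1" "hh_h' \<in> (hh_low_zero 1 :: 'a fps fps set)"
    by (auto simp: hh_low_zero_def hh_h_def hh_h'_def fps_X_nth)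
  then show "{hh_h ^ i * hh_h' ^ j |i j. i + j = n} \<subseteq> (hh_low_zero n :: 'a fps fps set)"
    using hh_low_zero_mult hh_low_zero_power by blast
qed

lemma hh_separated:
  assumes "\<And>n. f \<in> hh_power n"
  shows "f = 0"
proof (intro fps_ext)
  fix b a
  have "f \<in> hh_low_zero (Suc (a + b))" using assms hh_power_low_zero by blast
  then show "f $ b $ a = 0 $ b $ a" by (simp add: hh_low_zero_def)
qed

text \<open>A homomorphism that fixes \<open>h\<close> and \<open>h'\<close> is continuous, and the target is separated, so that a kernel
  is closed.\<close>

lemma hh_closure_kernel:
  assumes "unital_hom F" and hh: "F hh_h = hh_h" "F hh_h' = hh_h'"
    and "\<And>x. x \<in> S \<Longrightarrow> F x = 0" "f \<in> hh_closure S"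
  shows "F f = 0"
proof (rule hh_separated)
  interpret unital_hom F by fact
  fix n
  have "ideal {x. F x \<in> hh_power n} ring_of_type_algebra"
    by (rule ideal_of_type_algebraI) (auto simp: ring_ops hh_powerD)
  then have le: "hh_power n \<subseteq> {x. F x \<in> hh_power n}"
    unfolding hh_power_def[where ?'a = 'a]
    by (rule genideal_subset) (auto simp: ring_ops hh hh_power_gen)
  obtain s where "s \<in> S" "f - s \<in> hh_power n"
    using assms(5) unfolding hh_closure_def by blast
  then show "F f \<in> hh_power n"
    using le assms(4) diff[of f s] by auto
qed

text \<open>The elements of the kernel are approximated one degree at a time. If the constant term of an
  element of the kernel is corrected by an element of the ideal, the rest is \<open>h u + h' v\<close>; by regularity of \<open>h, h'\<close>
  in the target and by surjectivity, \<open>u\<close> and \<open>v\<close> can be changed by multiples of \<open>h'\<close> and \<open>h\<close> so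
  that they lie in the kernel again.\<close>

lemma kernel_le_hh_closure:
  assumes "unital_hom F" and hh: "F hh_h = hh_h" "F hh_h' = hh_h'" and "surj F"
    and I: "ideal I ring_of_type_algebra" and FI: "\<And>x. x \<in> I \<Longrightarrow> F x = 0"
    and const: "\<And>f. F f = 0 \<Longrightarrow> \<exists>s\<in>I. s $ 0 $ 0 = f $ 0 $ 0"
    and "F f = 0"
  shows "f \<in> hh_closure I"
proof -
  interpret unital_hom F by fact
  note ID = ideal_of_type_algebraD[OF I]
  have "\<exists>s\<in>I. f - s \<in> hh_power n" for n
    using \<open>F f = 0\<close>
  proof (induction n arbitrary: f)
    case 0
    then show ?case using ID(1) by (auto simp: hh_power_0)
  next
    case (Suc n)
    obtain s where s: "s \<in> I" "s $ 0 $ 0 = f $ 0 $ 0" using const[OF Suc.prems] by blast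
    then have "(f - s) $ 0 $ 0 = 0" by simp
    then obtain u v where uv: "f - s = hh_h * u + hh_h' * v" by (rule hh_decompose)
    have "hh_h * F u + hh_h' * F v = F (f - s)"
      by (simp add: uv ring_ops hh)
    then have "hh_h * F u + hh_h' * F v = 0"
      using FI[OF s(1)] Suc.prems by (simp add: diff)
    then obtain w where w: "F u = hh_h' * w" "F v = - (hh_h * w)" by (rule hh_syzygy)
    obtain x where x: "w = F x" using \<open>surj F\<close> by blast
    have "F (u - hh_h' * x) = 0" "F (v + hh_h * x) = 0"
      by (simp_all add: ring_ops hh w flip: x)
    then obtain p q where p: "p \<in> I" "u - hh_h' * x - p \<in> hh_power n"
      and q: "q \<in> I" "v + hh_h * x - q \<in> hh_power n"
      using Suc.IH by metis
    have comm: "hh_h * (hh_h' * x) = hh_h' * (hh_h * x)"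
      by (metis hh_h_central mult.assoc)
    have "f - (s + (hh_h * p + hh_h' * q)) = (f - s) - hh_h * p - hh_h' * q"
      by simp
    also have "\<dots> = hh_h * (u - hh_h' * x - p) + hh_h' * (v + hh_h * x - q)"
      unfolding uv using comm by (simp add: algebra_simps)
    also have "\<dots> \<in> hh_power (Suc n)"
      using p q by (intro hh_powerD(2)[OF h_mult_hh_power h'_mult_hh_power])
    finally show ?case
      using s p q by (intro bexI[of _ "s + (hh_h * p + hh_h' * q)"]) (auto intro!: ID(2,3))
  qed
  then show ?thesis by (simp add: hh_closure_def)
qed

section \<open>The quotients of hyperbolic sines\<close>

lemma unital_hom_ps_scalar: "unital_hom ps_scalar"
  by unfold_locales (simp_all add: ps_scalar_def hh_const_def fps_const_mult one_pCons)

interpretation ps_scalar: unital_hom ps_scalar by (rule unital_hom_ps_scalar)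

text \<open>The series \<open>\<Sum>\<^sub>n c\<^sub>n f\<^sup>n\<close>, truncated in each coefficient as in the definition of \<^const>\<open>ps_exp\<close>.\<close>

definition ps_series :: "(nat \<Rightarrow> complex) \<Rightarrow> pser \<Rightarrow> pser" where
  "ps_series c f = Abs_fps (\<lambda>b. Abs_fps (\<lambda>a.
     \<Sum>n\<le>a + b. (ps_scalar (c n) * f ^ n) $ b $ a))"

lemma ps_series_nth:
  "ps_series c f $ b $ a = (\<Sum>n\<le>a + b. (ps_scalar (c n) * f ^ n) $ b $ a)"
  by (simp add: ps_series_def)

lemma hh_low_zero_mult_right: "f \<in> hh_low_zero n \<Longrightarrow> f * g \<in> hh_low_zero n"
  using hh_low_zero_mult[of f n g 0] by (simp add: hh_low_zero_def)

lemma hh_low_zero_mult_left: "g \<in> hh_low_zero n \<Longrightarrow> f * g \<in> hh_low_zero n"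
  using hh_low_zero_mult[of f 0 g n] by (simp add: hh_low_zero_def)

text \<open>Terms of order greater than \<open>a + b\<close> do not contribute to the coefficient of \<open>h\<^sup>a h'\<^sup>b\<close>, which makes
  it possible to use one finite sum for all coefficients that enter a product.\<close>

lemma ps_series_nth_trunc:
  assumes f: "f \<in> hh_low_zero 1" and "a + b \<le> N"
  shows "ps_series c f $ b $ a = (\<Sum>n\<le>N. ps_scalar (c n) * f ^ n) $ b $ a"
proof -
  have "(ps_scalar (c n) * f ^ n) $ b $ a = 0" if "n > a + b" for n
    using hh_low_zero_mult_left[OF hh_low_zero_power[OF f], of "ps_scalar (c n)" n] that
    by (simp add: hh_low_zero_def add.commute)
  then have "(\<Sum>n\<le>a + b. (ps_scalar (c n) * f ^ n) $ b $ a) = (\<Sum>n\<le>N. (ps_scalar (c n) * f ^ n) $ b $ a)"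
    using assms(2) by (intro sum.mono_neutral_left) auto
  then show ?thesis by (simp add: ps_series_nth fps_sum_nth)
qed

lemma ps_series_shift:
  assumes f: "f \<in> hh_low_zero 1" and "c 0 = 0"
  shows "ps_series c f = f * ps_series (\<lambda>n. c (Suc n)) f"
proof (intro fps_ext)
  fix b a
  let ?t = "\<Sum>n\<le>a + b. ps_scalar (c (Suc n)) * f ^ n"
  have "(f * ps_series (\<lambda>n. c (Suc n)) f) $ b $ a = (f * ?t) $ b $ a"
    unfolding fps_mult_nth fps_sum_nth[of _ _ a] fps_sum_nth[of _ "{0..b}"]
    by (intro sum.cong refl arg_cong2[where f = "(*)"] ps_series_nth_trunc[OF f]) auto
  also have "f * ?t = (\<Sum>n\<le>a + b. ps_scalar (c (Suc n)) * f ^ Suc n)"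
    by (simp add: sum_distrib_left algebra_simps)
  also have "\<dots> = (\<Sum>n\<le>Suc (a + b). ps_scalar (c n) * f ^ n)"
    unfolding sum.atMost_Suc_shift by (simp add: assms(2) ps_scalar.zero)
  also have "\<dots> $ b $ a = ps_series c f $ b $ a"
    by (rule ps_series_nth_trunc[OF f, symmetric]) simp
  finally show "ps_series c f $ b $ a = (f * ps_series (\<lambda>n. c (Suc n)) f) $ b $ a" by simp
qed

lemma ps_series_uminus: "ps_series c (- f) = ps_series (\<lambda>n. (- 1) ^ n * c n) f"
proof -
  have "ps_scalar (c n) * (- f) ^ n = ps_scalar ((- 1) ^ n * c n) * f ^ n" for n
    by (subst power_minus) (simp add: ps_scalar.ring_ops algebra_simps)
  then show ?thesis by (simp add: ps_series_def)
qed

lemma ps_series_diff: "ps_series c f - ps_series d f = ps_series (\<lambda>n. c n - d n) f"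
  by (intro fps_ext) (simp add: ps_series_nth ps_scalar.diff left_diff_distrib sum_subtractf)

lemma ps_exp_series: "ps_exp = ps_series (\<lambda>n. 1 / fact n)"
  by (intro ext) (simp add: ps_exp_def ps_series_def)

text \<open>The power series of \<open>2 sinh(f) / f\<close>, which has constant term \<open>2\<close>.\<close>

definition ps_sinhc :: "pser \<Rightarrow> pser" where
  "ps_sinhc = ps_series (\<lambda>n. (1 - (- 1) ^ Suc n) / fact (Suc n))"

text \<open>The even terms of \<open>e\<^sup>f - e\<^sup>-\<^sup>f\<close> cancel, in particular the constant one, so that \<open>f\<close> can be divided off.\<close>

lemma ps_exp_diff:
  assumes "f \<in> hh_low_zero 1"
  shows "ps_exp f - ps_exp (- f) = f * ps_sinhc f"
proof -
  have "ps_exp f - ps_exp (- f) = ps_series (\<lambda>n. (1 - (- 1) ^ n) / fact n) f"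
    by (simp add: ps_exp_series ps_series_uminus ps_series_diff diff_divide_distrib)
  also have "\<dots> = f * ps_sinhc f"
    unfolding ps_sinhc_def by (rule ps_series_shift[OF assms]) simp
  finally show ?thesis .
qed

lemma ps_sinhc_nth_0: "ps_sinhc f $ 0 $ 0 = [:[:2:]:]"
  by (simp add: ps_sinhc_def ps_series_nth ps_scalar_def hh_const_def)

lemma ps_sinhc_nonzero: "ps_sinhc f \<noteq> 0"
  using ps_sinhc_nth_0[of f] by auto

text \<open>The constant term is invertible, hence the series is a unit and can serve as a denominator.\<close>

lemma ps_sinhc_invertible: "\<exists>w. ps_sinhc f * w = 1"
proof -
  let ?u = "ps_sinhc f" and ?y = "[:[:1 / 2:]:] :: complex poly poly"
  have "?u $ 0 $ 0 * ?y = 1" by (simp add: ps_sinhc_nth_0 one_pCons)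
  then have "?u $ 0 * fps_right_inverse (?u $ 0) ?y = 1" by (rule fps_right_inverse)
  then have "?u * fps_right_inverse ?u (fps_right_inverse (?u $ 0) ?y) = 1"
    by (rule fps_right_inverse)
  then show ?thesis ..
qed

lemma ps_quot_eqI:
  assumes "d \<noteq> 0" "d * q = f"
  shows "ps_quot f d = q"
  unfolding ps_quot_def using assms by (intro the_equality) auto

lemma log_QT_low: "log_QT g x \<in> hh_low_zero 1"
  by (auto simp: log_QT_def hh_low_zero_def hh_h_def hh_h'_def)

lemma log_QT_nonzero: "log_QT g x \<noteq> 0"
proof
  assume "log_QT g x = 0"
  then have "log_QT g x $ 0 $ 1 = 0" by simp
  then show False by (simp add: log_QT_def hh_h_def hh_h'_def)
qed

text \<open>The factor \<open>sinh(L x) / (x sinh(L))\<close> with \<open>L = h + h' {x}\<^sub>Q\<close>, as a quotient of series with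
  constant term \<open>2\<close>.\<close>

definition QT_ratio :: "nat \<Rightarrow> pser \<Rightarrow> pser" where
  "QT_ratio g x = ps_quot (ps_sinhc (log_QT g x * x)) (ps_sinhc (log_QT g x))"

lemma QT_ratio_eqI:
  "ps_sinhc (log_QT g x) * q = ps_sinhc (log_QT g x * x) \<Longrightarrow> QT_ratio g x = q"
  unfolding QT_ratio_def by (rule ps_quot_eqI[OF ps_sinhc_nonzero])

lemma QT_ratio_mult: "ps_sinhc (log_QT g x) * QT_ratio g x = ps_sinhc (log_QT g x * x)"
proof -
  obtain w where w: "ps_sinhc (log_QT g x) * w = 1" using ps_sinhc_invertible by blast
  have eq: "ps_sinhc (log_QT g x) * (w * ps_sinhc (log_QT g x * x)) = ps_sinhc (log_QT g x * x)"
    by (simp add: w flip: mult.assoc)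
  show ?thesis using QT_ratio_eqI[OF eq] eq by simp
qed

lemma QT_ratio_nth_0: "QT_ratio g x $ 0 $ 0 = 1"
proof -
  have "[:[:2:]:] * (QT_ratio g x $ 0 $ 0) = [:[:2:]:] * 1"
    using arg_cong[OF QT_ratio_mult[of g x], of "\<lambda>f. f $ 0 $ 0"] by (simp add: ps_sinhc_nth_0)
  then show ?thesis by (subst (asm) mult_left_cancel) simp_all
qed

text \<open>Numerator and denominator are values of \<open>2 sinh\<close> at \<open>L x\<close> and at \<open>L\<close>. Therefore a factor of the
  defining relations of the deformed algebra is \<open>x\<close> times the corresponding factor of \<open>\<psi>(X\<^sup>+)\<close>.\<close>

lemma QT_num_eq: "QT_num g x = log_QT g x * x * ps_sinhc (log_QT g x * x)"
  using ps_exp_diff[OF hh_low_zero_mult_right[OF log_QT_low], of g x x]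
  by (simp add: QT_num_def QT_power_def)

lemma QT_den_eq: "QT_den g x = log_QT g x * ps_sinhc (log_QT g x)"
  using ps_exp_diff[OF log_QT_low, of g x] by (simp add: QT_den_def QT_power_def)

lemma relation_factor:
  "ps_quot (ps_quot (QT_num g x) (log_QT g x)) (ps_quot (QT_den g x) (log_QT g x)) =
    x * QT_ratio g x"
proof -
  have "ps_quot (QT_num g x) (log_QT g x) = x * ps_sinhc (log_QT g x * x)"
    by (rule ps_quot_eqI[OF log_QT_nonzero]) (simp add: QT_num_eq)
  moreover have "ps_quot (QT_den g x) (log_QT g x) = ps_sinhc (log_QT g x)"
    by (rule ps_quot_eqI[OF log_QT_nonzero]) (simp add: QT_den_eq)
  moreover have "ps_quot (x * ps_sinhc (log_QT g x * x)) (ps_sinhc (log_QT g x)) = x * QT_ratio g x"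
    by (rule ps_quot_eqI[OF ps_sinhc_nonzero]) (simp add: QT_ratio_mult mult.left_commute)
  ultimately show ?thesis by simp
qed

lemma psi_factor:
  assumes "x \<noteq> 0"
  shows "ps_quot (ps_quot (QT_num g x) (log_QT g x * x)) (ps_quot (QT_den g x) (log_QT g x)) =
    QT_ratio g x"
proof -
  have "ps_quot (QT_num g x) (log_QT g x * x) = ps_sinhc (log_QT g x * x)"
    by (rule ps_quot_eqI) (simp_all add: QT_num_eq assms log_QT_nonzero)
  moreover have "ps_quot (QT_den g x) (log_QT g x) = ps_sinhc (log_QT g x)"
    by (rule ps_quot_eqI[OF log_QT_nonzero]) (simp add: QT_den_eq)
  ultimately show ?thesis by (simp add: QT_ratio_def)
qed

text \<open>All the series are built from \<open>x\<close> by operations that are natural with respect to endomorphisms of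
  the coefficient ring \<open>\<complex>[H,\<surd>C]\<close> which fix the scalars. This yields their behaviour under
  \<open>H \<mapsto> H + 2\<close>.\<close>

locale scalar_fixing_hom = unital_hom \<rho>
  for \<rho> :: "complex poly poly \<Rightarrow> complex poly poly" +
  assumes fixes_scalars: "\<rho> [:[:c:]:] = [:[:c:]:]"
begin

sublocale map: unital_hom "hh_map \<rho>"
  by (rule unital_hom_hh_map) unfold_locales

lemma map_const: "hh_map \<rho> (hh_const p) = hh_const (\<rho> p)"
  by (intro fps_ext) (simp add: hh_map_def hh_const_def zero)

lemma map_scalar: "hh_map \<rho> (ps_scalar c) = ps_scalar c"
  by (simp add: ps_scalar_def map_const fixes_scalars)

lemma map_h: "hh_map \<rho> hh_h = hh_h" and map_h': "hh_map \<rho> hh_h' = hh_h'"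
  by (intro fps_ext, simp add: hh_map_def hh_h_def hh_h'_def fps_X_nth zero one)+

lemma map_series: "hh_map \<rho> (ps_series c f) = ps_series c (hh_map \<rho> f)"
proof (intro fps_ext)
  fix b a
  have "hh_map \<rho> (ps_series c f) $ b $ a = (\<Sum>n\<le>a + b. hh_map \<rho> (ps_scalar (c n) * f ^ n) $ b $ a)"
    by (simp add: hh_map_def ps_series_nth sum)
  then show "hh_map \<rho> (ps_series c f) $ b $ a = ps_series c (hh_map \<rho> f) $ b $ a"
    by (simp add: ps_series_nth map.mult map.power map_scalar)
qed

lemma map_log_QT: "hh_map \<rho> (log_QT g x) = log_QT g (hh_map \<rho> x)"
proof -
  have "hh_map \<rho> (P_fun g u v) = P_fun g (hh_map \<rho> u) (hh_map \<rho> v)" for u v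
    by (simp add: P_fun_def Let_def map.ring_ops map_scalar unital_hom_prod[OF map.unital_hom_axioms])
  then show ?thesis
    by (simp add: log_QT_def bracket_Q_def map.ring_ops map_h map_h' ps_exp_series map_series)
qed

lemma map_QT_ratio: "hh_map \<rho> (QT_ratio g x) = QT_ratio g (hh_map \<rho> x)"
proof (rule QT_ratio_eqI[symmetric])
  have "hh_map \<rho> (ps_sinhc (log_QT g x) * QT_ratio g x) = hh_map \<rho> (ps_sinhc (log_QT g x * x))"
    by (simp add: QT_ratio_mult)
  then show "ps_sinhc (log_QT g (hh_map \<rho> x)) * hh_map \<rho> (QT_ratio g x) =
      ps_sinhc (log_QT g (hh_map \<rho> x) * hh_map \<rho> x)"
    by (simp add: map.mult ps_sinhc_def map_series map_log_QT)
qed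

end

lemma H_e_const: "H_e e s = hh_const [:[:- s * e / 2, e / 2:], [:1 / 2:]:]"
  by (simp add: H_e_def ps_scalar_def ps_sqrtC_def ps_H_def hh_const_def fps_const_mult)

definition ratio_pair :: "nat \<Rightarrow> complex \<Rightarrow> pser" where
  "ratio_pair g s = QT_ratio g (H_e 1 s) * QT_ratio g (H_e (- 1) s)"

text \<open>The product \<open>H\<^sub>1 H\<^sub>-\<^sub>1 = (C - (H - s)\<^sup>2) / 4\<close>.\<close>

definition H_e_pair :: "complex \<Rightarrow> complex poly poly" where
  "H_e_pair s = [:[:- s * s / 4, s / 2, - 1 / 4:], 0, [:1 / 4:]:]"

lemma psi_series_eq: "psi_series g = ratio_pair g 1"
proof -
  have "H_e e 1 \<noteq> 0" for e
    by (simp add: H_e_const hh_const_def)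
  then show ?thesis by (simp add: psi_series_def psi_factor ratio_pair_def)
qed

text \<open>The first factor is the classical limit; the second one, with constant term \<open>1\<close>, is what the
  rescaling of \<open>X\<^sup>+\<close> has to absorb.\<close>

lemma relation_series_eq: "relation_series g s = hh_const (H_e_pair s) * ratio_pair g s"
proof -
  have "H_e 1 s * H_e (- 1) s = hh_const (H_e_pair s)"
    by (simp add: H_e_const hh_const_def H_e_pair_def fps_const_mult)
  moreover have "relation_series g s = (H_e 1 s * H_e (- 1) s) * ratio_pair g s"
    by (simp add: relation_series_def relation_factor ratio_pair_def mult_ac)
  ultimately show ?thesis by simp
qed

lemma ratio_pair_nth_0: "ratio_pair g s $ 0 $ 0 = 1"
  by (simp add: ratio_pair_def QT_ratio_nth_0)

lemma relation_series_nth_0: "relation_series g s $ 0 $ 0 = H_e_pair s"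
  by (simp add: relation_series_eq ratio_pair_nth_0 hh_const_def)

definition shift_H :: "complex poly poly \<Rightarrow> complex poly poly" where
  "shift_H = map_poly (\<lambda>p. pcompose p [:2, 1:])"

lemma coeff_shift_H: "coeff (shift_H p) n = pcompose (coeff p n) [:2, 1:]"
  by (simp add: shift_H_def coeff_map_poly)

lemma scalar_fixing_shift_H: "scalar_fixing_hom shift_H"
proof
  show "shift_H 1 = 1"
    by (rule poly_eqI) (simp add: coeff_shift_H coeff_1 pcompose_1)
  show "shift_H (x + y) = shift_H x + shift_H y" for x y
    by (rule poly_eqI) (simp add: coeff_shift_H pcompose_add)
  show "shift_H (x * y) = shift_H x * shift_H y" for x y
    by (rule poly_eqI) (simp add: coeff_shift_H coeff_mult pcompose_sum pcompose_mult)
  show "shift_H [:[:c:]:] = [:[:c:]:]" for c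
    by (rule poly_eqI) (simp add: coeff_shift_H coeff_pCons pcompose_const split: nat.split)
qed

lemma shift_H_pCons: "shift_H (pCons a p) = pCons (pcompose a [:2, 1:]) (shift_H p)"
  by (rule poly_eqI) (simp add: coeff_shift_H coeff_pCons split: nat.split)

lemma shift_H_0: "shift_H 0 = 0"
  by (simp add: shift_H_def)

text \<open>The substitution \<open>H \<mapsto> H + 2\<close> turns \<open>H\<^sub>e\<^sup>+\<close> into \<open>H\<^sub>e\<^sup>-\<close>.\<close>

lemma ratio_pair_shift: "hh_map shift_H (ratio_pair g 1) = ratio_pair g (- 1)"
proof -
  interpret scalar_fixing_hom shift_H by (rule scalar_fixing_shift_H)
  have "hh_map shift_H (H_e e 1) = H_e e (- 1)" for e
    by (simp add: H_e_const map_const shift_H_pCons shift_H_0 pcompose_pCons)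
  then show ?thesis by (simp add: ratio_pair_def map.mult map_QT_ratio)
qed

section \<open>Evaluation of polynomials in a noncommutative ring\<close>

text \<open>Evaluation at \<open>x\<close>, with coefficients that act from the left through \<open>\<eta>\<close>. It is a homomorphism if
  \<open>x\<close> commutes with the image of \<open>\<eta>\<close>, although the target need not be commutative.\<close>

definition poly_ev :: "('c :: comm_ring_1 \<Rightarrow> 'a :: ring_1) \<Rightarrow> 'a \<Rightarrow> 'c poly \<Rightarrow> 'a" where
  "poly_ev \<eta> x p = (\<Sum>i\<le>degree p. \<eta> (coeff p i) * x ^ i)"

lemma poly_ev_bound:
  assumes "\<eta> 0 = 0" "degree p \<le> n"
  shows "poly_ev \<eta> x p = (\<Sum>i\<le>n. \<eta> (coeff p i) * x ^ i)"
  unfolding poly_ev_def using assms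
  by (intro sum.mono_neutral_left) (auto simp: coeff_eq_0)

lemma poly_ev_0: "\<eta> 0 = 0 \<Longrightarrow> poly_ev \<eta> x 0 = 0"
  by (simp add: poly_ev_def)

lemma poly_ev_pCons:
  assumes "\<eta> 0 = 0"
  shows "poly_ev \<eta> x (pCons a p) = \<eta> a + poly_ev \<eta> x p * x"
proof -
  have "poly_ev \<eta> x (pCons a p) = (\<Sum>i\<le>Suc (degree p). \<eta> (coeff (pCons a p) i) * x ^ i)"
    by (rule poly_ev_bound[where \<eta> = \<eta>, OF assms]) (simp add: degree_pCons_le)
  also have "\<dots> = \<eta> a + (\<Sum>i\<le>degree p. \<eta> (coeff p i) * x ^ Suc i)"
    by (simp only: sum.atMost_Suc_shift) simp
  also have "(\<Sum>i\<le>degree p. \<eta> (coeff p i) * x ^ Suc i) = poly_ev \<eta> x p * x"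
    by (simp add: poly_ev_def sum_distrib_right mult.assoc flip: power_Suc2)
  finally show ?thesis .
qed

lemma poly_ev_add:
  assumes "unital_hom \<eta>"
  shows "poly_ev \<eta> x (p + q) = poly_ev \<eta> x p + poly_ev \<eta> x q"
proof -
  interpret unital_hom \<eta> by fact
  let ?n = "max (degree p) (degree q)"
  have "degree (p + q) \<le> ?n" by (rule degree_add_le_max)
  then show ?thesis
    by (simp add: poly_ev_bound[where \<eta> = \<eta> and n = ?n, OF zero] add distrib_right sum.distrib)
qed

lemma unital_hom_poly_ev:
  assumes "unital_hom \<eta>" and comm: "\<And>c. \<eta> c * x = x * \<eta> c"
  shows "unital_hom (poly_ev \<eta> x)"
proof -
  interpret unital_hom \<eta> by fact
  note pCons = poly_ev_pCons[where \<eta> = \<eta>, OF zero]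
  have comm_ev: "poly_ev \<eta> x p * x = x * poly_ev \<eta> x p" for p
    by (induction p) (simp_all add: poly_ev_0 zero pCons algebra_simps comm)
  have smult: "poly_ev \<eta> x (smult a p) = \<eta> a * poly_ev \<eta> x p" for a p
  proof -
    have "\<eta> b * \<eta> a = \<eta> a * \<eta> b" for b
      by (simp add: mult.commute flip: mult)
    then show ?thesis
      by (induction p) (simp_all add: poly_ev_0 zero pCons algebra_simps mult)
  qed
  show ?thesis
  proof
    show "poly_ev \<eta> x 1 = 1" by (simp add: poly_ev_def one)
    show "poly_ev \<eta> x (p + q) = poly_ev \<eta> x p + poly_ev \<eta> x q" for p q
      by (rule poly_ev_add[OF assms(1)])
    show "poly_ev \<eta> x (p * q) = poly_ev \<eta> x p * poly_ev \<eta> x q" for p q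
    proof (induction p)
      case 0
      then show ?case by (simp add: poly_ev_0 zero)
    next
      case (pCons a p)
      have "poly_ev \<eta> x (pCons a p * q) = \<eta> a * poly_ev \<eta> x q + poly_ev \<eta> x p * poly_ev \<eta> x q * x"
        by (simp add: poly_ev_add[OF assms(1)] smult pCons.IH
            poly_ev_pCons[where \<eta> = \<eta>, OF zero] zero)
      also have "\<dots> = poly_ev \<eta> x (pCons a p) * poly_ev \<eta> x q"
        by (simp add: poly_ev_pCons[where \<eta> = \<eta>, OF zero] distrib_right mult.assoc comm_ev[of q])
      finally show ?case .
    qed
  qed
qed

lemma poly_ev_commute:
  assumes "unital_hom \<eta>" "\<And>c. \<eta> c * y = y * \<eta> c" "x * y = y * x"
  shows "poly_ev \<eta> x p * y = y * poly_ev \<eta> x p"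
proof -
  interpret unital_hom \<eta> by fact
  have "poly_ev \<eta> x p * x * y = y * (poly_ev \<eta> x p * x)"
    if "poly_ev \<eta> x p * y = y * poly_ev \<eta> x p" for p
    by (metis that assms(3) mult.assoc)
  then show ?thesis
    by (induction p)
      (simp_all add: poly_ev_0 zero poly_ev_pCons[where \<eta> = \<eta>, OF zero] distrib_left distrib_right assms(2))
qed

text \<open>The even part of \<open>p\<close>, as a polynomial in the square of the variable: \<open>q(s\<^sup>2)\<close> is mapped to \<open>q\<close>.\<close>

definition halve_poly :: "'c :: comm_ring_1 poly \<Rightarrow> 'c poly" where
  "halve_poly p = (\<Sum>j\<le>degree p. monom (coeff p (2 * j)) j)"

lemma coeff_halve_poly: "coeff (halve_poly p) j = coeff p (2 * j)"
proof -
  have "coeff p (2 * j) = 0" if "j > degree p" using that by (intro coeff_eq_0) simp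
  then show ?thesis
    by (auto simp: halve_poly_def coeff_sum if_distrib cong: if_cong)
qed

lemma degree_halve_poly: "degree (halve_poly p) \<le> degree p"
  by (rule degree_le) (auto simp: coeff_halve_poly intro: coeff_eq_0)

text \<open>If \<open>p\<close> is even, the even part of \<open>p q\<close> only involves the even part of \<open>q\<close>.\<close>

lemma halve_poly_mult:
  assumes "\<And>n. odd n \<Longrightarrow> coeff p n = 0"
  shows "halve_poly (p * q) = halve_poly p * halve_poly q"
proof (rule poly_eqI)
  fix j
  have "coeff (halve_poly (p * q)) j = (\<Sum>i\<le>2 * j. coeff p i * coeff q (2 * j - i))"
    by (simp add: coeff_halve_poly coeff_mult)
  also have "\<dots> = (\<Sum>i\<in>(*) 2 ` {..j}. coeff p i * coeff q (2 * j - i))"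
  proof (rule sum.mono_neutral_right)
    show "\<forall>i\<in>{..2 * j} - (*) 2 ` {..j}. coeff p i * coeff q (2 * j - i) = 0"
    proof
      fix i assume i: "i \<in> {..2 * j} - (*) 2 ` {..j}"
      have "odd i"
      proof
        assume "even i"
        then obtain k where "i = 2 * k" by (elim evenE)
        then show False using i by auto
      qed
      then show "coeff p i * coeff q (2 * j - i) = 0" using assms by simp
    qed
  qed auto
  also have "\<dots> = (\<Sum>i\<le>j. coeff p (2 * i) * coeff q (2 * (j - i)))"
    by (subst sum.reindex) (auto simp: inj_on_def right_diff_distrib')
  also have "\<dots> = coeff (halve_poly p * halve_poly q) j"
    by (simp add: coeff_mult coeff_halve_poly)
  finally show "coeff (halve_poly (p * q)) j = coeff (halve_poly p * halve_poly q) j" .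
qed

lemma halve_poly_H_e_pair:
  "halve_poly (H_e_pair s) = [:[:- s * s / 4, s / 2, - 1 / 4:], [:1 / 4:]:]"
  by (rule poly_eqI) (simp add: coeff_halve_poly H_e_pair_def coeff_pCons split: nat.split)

lemma halve_poly_shift_H: "halve_poly (shift_H p) = shift_H (halve_poly p)"
  by (rule poly_eqI) (simp add: coeff_halve_poly coeff_shift_H)

text \<open>This form makes the substitution a composition of homomorphisms as soon as \<open>H\<close> and \<open>C\<close> commute.\<close>

lemma subst_HC_poly_ev:
  assumes "unital_hom \<eta>"
  shows "subst_HC \<eta> H C p = poly_ev (poly_ev \<eta> H) C (halve_poly p)"
proof -
  have "poly_ev \<eta> H 0 = 0" by (rule poly_ev_0) (rule unital_hom.zero[OF assms])
  then have "poly_ev (poly_ev \<eta> H) C (halve_poly p) =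
      (\<Sum>j\<le>degree p. poly_ev \<eta> H (coeff p (2 * j)) * C ^ j)"
    by (simp add: poly_ev_bound[where \<eta> = "poly_ev \<eta> H", OF _ degree_halve_poly] coeff_halve_poly)
  then show ?thesis
    by (simp add: subst_HC_def poly_ev_def[of \<eta>] sum_distrib_right)
qed

lemma four_mult: "4 * x = x + x + x + (x :: 'a :: ring_1)"
proof -
  have "(4 :: 'a) = 1 + 1 + 1 + 1" by simp
  then show ?thesis by (simp only: distrib_right mult_1_left)
qed

lemma (in central_scalars) quarter: "4 * (\<eta> (1 / 4) * x) = x"
proof -
  have "4 * \<eta> (1 / 4) = \<eta> (4 * (1 / 4))" unfolding \<eta>.mult \<eta>.numeral ..
  then show ?thesis by (simp add: \<eta>.one flip: mult.assoc)
qed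

text \<open>As \<open>H\<close> and \<open>C\<close> do not occur in a common monomial of \<open>(C - (H - s)\<^sup>2) / 4\<close>, this identity and the next
  one are also valid in the free algebra, where \<open>H\<close> and \<open>C\<close> do not commute.\<close>

lemma (in central_scalars) subst_HC_H_e_pair:
  "subst_HC \<eta> H C (H_e_pair s) = \<eta> (1 / 4) * (C - (H - \<eta> s)\<^sup>2)"
proof -
  have zero: "poly_ev \<eta> H 0 = 0" by (simp add: poly_ev_0 \<eta>.zero)
  have s: "\<eta> (- s * s / 4) = - (\<eta> (1 / 4) * (\<eta> s * \<eta> s))" "\<eta> (s / 2) = \<eta> (1 / 4) * (\<eta> s + \<eta> s)"
    "\<eta> (- 1 / 4) = - \<eta> (1 / 4)"
    by (simp_all flip: \<eta>.mult \<eta>.add \<eta>.uminus)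
  have "(H - \<eta> s)\<^sup>2 = H * H - (\<eta> s + \<eta> s) * H + \<eta> s * \<eta> s"
    by (simp add: power2_eq_square algebra_simps central[of s H])
  then have sq: "(H - \<eta> s)\<^sup>2 = H * H - \<eta> s * H - \<eta> s * H + \<eta> s * \<eta> s"
    by (simp add: distrib_right)
  have "subst_HC \<eta> H C (H_e_pair s) =
      \<eta> (- s * s / 4) + (\<eta> (s / 2) + \<eta> (- 1 / 4) * H) * H + \<eta> (1 / 4) * C"
    unfolding subst_HC_poly_ev[OF \<eta>.unital_hom_axioms] halve_poly_H_e_pair
    by (simp only: poly_ev_pCons[where \<eta> = "poly_ev \<eta> H", OF zero] poly_ev_pCons[where \<eta> = \<eta>, OF \<eta>.zero]
        poly_ev_0[where \<eta> = "poly_ev \<eta> H", OF zero] poly_ev_0[where \<eta> = \<eta>, OF \<eta>.zero]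
        add_0_left add_0_right mult_zero_left)
  also have "\<dots> = \<eta> (1 / 4) * (C - (H - \<eta> s)\<^sup>2)"
    unfolding s sq by (simp add: algebra_simps)
  finally show ?thesis .
qed

lemma (in central_scalars) subst_HC_H_e_pair_diff:
  "subst_HC \<eta> H C (H_e_pair 1) - subst_HC \<eta> H C (H_e_pair (- 1)) = H"
proof -
  have "(C - (H - 1)\<^sup>2) - (C - (H + 1)\<^sup>2) = 4 * H"
    by (simp add: power2_eq_square algebra_simps four_mult)
  then have "subst_HC \<eta> H C (H_e_pair 1) - subst_HC \<eta> H C (H_e_pair (- 1)) = \<eta> (1 / 4) * (4 * H)"
    unfolding subst_HC_H_e_pair by (simp add: \<eta>.one \<eta>.uminus flip: right_diff_distrib)
  also have "\<dots> = 4 * (\<eta> (1 / 4) * H)"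
    using \<eta>.numeral central by (metis mult.assoc)
  finally show ?thesis by (simp add: quarter)
qed

lemma hh_map_mult_even:
  assumes E: "\<And>p q. E (p + q) = E p + E q"
    "\<And>p q. (\<And>n. odd n \<Longrightarrow> coeff p n = 0) \<Longrightarrow> E (p * q) = E p * E q"
    and p: "\<And>n. odd n \<Longrightarrow> coeff p n = 0"
  shows "hh_map E (hh_const p * f) = hh_const (E p) * hh_map E f"
  by (intro fps_ext) (simp add: hh_map_def hh_const_def E p)


section \<open>The algebra \<open>U(sl\<^sub>2)\<close>\<close>

lemma unital_hom_abs_U_sl2: "unital_hom abs_U_sl2"
  by unfold_locales (simp_all add: one_U_sl2_def plus_U_sl2.abs_eq times_U_sl2.abs_eq)

interpretation abs_U_sl2: unital_hom abs_U_sl2 by (rule unital_hom_abs_U_sl2)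

lemma abs_U_sl2_eq_0: "abs_U_sl2 x = 0 \<longleftrightarrow> x \<in> sl2_ideal"
  by (simp add: zero_U_sl2_def U_sl2.abs_eq_iff sl2_cong_def)

lemma surj_abs_U_sl2: "surj abs_U_sl2"
proof -
  have "\<exists>x. y = abs_U_sl2 x" for y
    by (induction y rule: U_sl2.abs_induct) blast
  then show ?thesis by (simp add: surj_def)
qed

lemma central_scalars_sl2: "central_scalars sl2_scalar"
proof
  show "sl2_scalar c * x = x * sl2_scalar c" for c x
    by (induction x rule: U_sl2.abs_induct)
      (simp add: sl2_scalar_def free_scalar_commute flip: abs_U_sl2.mult)
qed (simp_all add: sl2_scalar_def free_scalar.ring_ops abs_U_sl2.ring_ops)

interpretation sl2: central_scalars sl2_scalar by (rule central_scalars_sl2)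

lemma sl2_relations_vanish: "r \<in> sl2_relations \<Longrightarrow> abs_U_sl2 r = 0"
  unfolding abs_U_sl2_eq_0 sl2_ideal_def using genideal_incl by blast

lemma sl2_H_Xp: "sl2_H * sl2_Xp = sl2_Xp * sl2_H + 2 * sl2_Xp"
  and sl2_H_Xm: "sl2_H * sl2_Xm = sl2_Xm * sl2_H - 2 * sl2_Xm"
  and sl2_Xp_Xm: "sl2_Xp * sl2_Xm = sl2_Xm * sl2_Xp + sl2_H"
proof -
  let ?Xp = "free_gen SXp" and ?Xm = "free_gen SXm" and ?H = "free_gen SH"
  have "abs_U_sl2 (?H * ?Xp - ?Xp * ?H - 2 * ?Xp) = 0" "abs_U_sl2 (?H * ?Xm - ?Xm * ?H + 2 * ?Xm) = 0"
    "abs_U_sl2 (?Xp * ?Xm - ?Xm * ?Xp - ?H) = 0"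
    by (intro sl2_relations_vanish, simp add: sl2_relations_def Let_def)+
  then show "sl2_H * sl2_Xp = sl2_Xp * sl2_H + 2 * sl2_Xp"
    "sl2_H * sl2_Xm = sl2_Xm * sl2_H - 2 * sl2_Xm"
    "sl2_Xp * sl2_Xm = sl2_Xm * sl2_Xp + sl2_H"
    by (simp_all add: abs_U_sl2.ring_ops sl2_H_def sl2_Xp_def sl2_Xm_def algebra_simps
        eq_diff_eq add_eq_0_iff2)
qed

lemma numeral_commute: "numeral n * x = x * (numeral n :: 'a :: ring_1)"
  by (metis mult_of_nat_commute of_nat_numeral)

text \<open>These two expressions of the Casimir element show that it is central: \<open>X\<^sup>+\<close> and \<open>X\<^sup>-\<close> carry one of
  them into the other.\<close>

lemma sl2_C_minus: "4 * (sl2_Xm * sl2_Xp) = sl2_C - (sl2_H + 1)\<^sup>2"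
  by (simp add: sl2_C_def mult.assoc)

lemma sl2_C_plus: "4 * (sl2_Xp * sl2_Xm) = sl2_C - (sl2_H - 1)\<^sup>2"
  by (simp add: sl2_C_def sl2_Xp_Xm power2_eq_square algebra_simps four_mult)

lemma sl2_C_Xp: "sl2_C * sl2_Xp = sl2_Xp * sl2_C"
proof -
  have H: "(sl2_H - 1) * sl2_Xp = sl2_Xp * (sl2_H + 1)"
    by (simp add: left_diff_distrib distrib_left sl2_H_Xp mult_2)
  have "sl2_C * sl2_Xp = (4 * (sl2_Xp * sl2_Xm) + (sl2_H - 1)\<^sup>2) * sl2_Xp"
    by (simp add: sl2_C_plus)
  also have "\<dots> = 4 * (sl2_Xp * sl2_Xm * sl2_Xp) + (sl2_H - 1) * ((sl2_H - 1) * sl2_Xp)"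
    by (simp add: distrib_right power2_eq_square mult.assoc)
  also have "(sl2_H - 1) * ((sl2_H - 1) * sl2_Xp) = sl2_Xp * (sl2_H + 1)\<^sup>2"
    unfolding H by (simp add: power2_eq_square H flip: mult.assoc)
  also have "4 * (sl2_Xp * sl2_Xm * sl2_Xp) = sl2_Xp * (4 * (sl2_Xm * sl2_Xp))"
    by (metis numeral_commute mult.assoc)
  finally show ?thesis by (simp add: sl2_C_minus distrib_left right_diff_distrib)
qed

lemma sl2_C_Xm: "sl2_C * sl2_Xm = sl2_Xm * sl2_C"
proof -
  have H: "(sl2_H + 1) * sl2_Xm = sl2_Xm * (sl2_H - 1)"
    by (simp add: distrib_right right_diff_distrib sl2_H_Xm mult_2)
  have "sl2_C * sl2_Xm = (4 * (sl2_Xm * sl2_Xp) + (sl2_H + 1)\<^sup>2) * sl2_Xm"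
    by (simp add: sl2_C_minus)
  also have "\<dots> = 4 * (sl2_Xm * sl2_Xp * sl2_Xm) + (sl2_H + 1) * ((sl2_H + 1) * sl2_Xm)"
    by (simp add: distrib_right power2_eq_square mult.assoc)
  also have "(sl2_H + 1) * ((sl2_H + 1) * sl2_Xm) = sl2_Xm * (sl2_H - 1)\<^sup>2"
    unfolding H by (simp add: power2_eq_square H flip: mult.assoc)
  also have "4 * (sl2_Xm * sl2_Xp * sl2_Xm) = sl2_Xm * (4 * (sl2_Xp * sl2_Xm))"
    by (metis numeral_commute mult.assoc)
  finally show ?thesis by (simp add: sl2_C_plus distrib_left right_diff_distrib)
qed

lemma sl2_C_H: "sl2_C * sl2_H = sl2_H * sl2_C"
proof -
  have "sl2_Xm * sl2_Xp * sl2_H = sl2_H * (sl2_Xm * sl2_Xp)"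
  proof -
    have "sl2_H * (sl2_Xm * sl2_Xp) = sl2_Xm * (sl2_H * sl2_Xp) - 2 * (sl2_Xm * sl2_Xp)"
      by (simp add: sl2_H_Xm left_diff_distrib mult.assoc flip: mult.assoc[of sl2_H])
    also have "sl2_Xm * (sl2_H * sl2_Xp) = sl2_Xm * sl2_Xp * sl2_H + 2 * (sl2_Xm * sl2_Xp)"
      by (simp add: sl2_H_Xp distrib_left mult.assoc) (metis numeral_commute mult.assoc)
    finally show ?thesis by simp
  qed
  then have "4 * (sl2_Xm * sl2_Xp) * sl2_H = sl2_H * (4 * (sl2_Xm * sl2_Xp))"
    by (metis numeral_commute mult.assoc)
  then show ?thesis
    unfolding sl2_C_minus by (simp add: power2_eq_square algebra_simps)
qed

definition sl2_ev :: "complex poly poly \<Rightarrow> U_sl2" where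
  "sl2_ev = poly_ev (poly_ev sl2_scalar sl2_H) sl2_C"

lemma unital_hom_sl2_ev: "unital_hom sl2_ev"
  unfolding sl2_ev_def
  by (intro unital_hom_poly_ev poly_ev_commute sl2.\<eta>.unital_hom_axioms sl2.central sl2_C_H[symmetric])

interpretation sl2_ev: unital_hom sl2_ev by (rule unital_hom_sl2_ev)

lemma subst_HC_sl2: "subst_HC sl2_scalar sl2_H sl2_C p = sl2_ev (halve_poly p)"
  by (simp add: sl2_ev_def subst_HC_poly_ev sl2.\<eta>.unital_hom_axioms)

text \<open>For \<open>h = h' = 0\<close> the deformed relations hold in \<open>U(sl\<^sub>2)\<close>.\<close>

lemma subst_HC_sl2_H_e_pair:
  "subst_HC sl2_scalar sl2_H sl2_C (H_e_pair 1) = sl2_Xp * sl2_Xm"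
  "subst_HC sl2_scalar sl2_H sl2_C (H_e_pair (- 1)) = sl2_Xm * sl2_Xp"
proof -
  have eq: "sl2_scalar (1 / 4) * (4 * x) = x" for x
    using sl2.quarter[of x] by (metis numeral_commute mult.assoc)
  show "subst_HC sl2_scalar sl2_H sl2_C (H_e_pair 1) = sl2_Xp * sl2_Xm"
    by (simp add: sl2.subst_HC_H_e_pair sl2.\<eta>.one eq flip: sl2_C_plus)
  show "subst_HC sl2_scalar sl2_H sl2_C (H_e_pair (- 1)) = sl2_Xm * sl2_Xp"
    by (simp add: sl2.subst_HC_H_e_pair sl2.\<eta>.one sl2.\<eta>.uminus eq flip: sl2_C_minus)
qed

text \<open>The element \<open>X\<^sup>-\<close> lowers the eigenvalues of \<open>H\<close> by \<open>2\<close> and commutes with \<open>C\<close>.\<close>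

lemma sl2_Xm_ev: "sl2_Xm * sl2_ev p = sl2_ev (shift_H p) * sl2_Xm"
proof -
  let ?e = "poly_ev sl2_scalar sl2_H"
  interpret e: unital_hom ?e
    by (intro unital_hom_poly_ev sl2.\<eta>.unital_hom_axioms sl2.central)
  note ev_pCons = poly_ev_pCons[where \<eta> = sl2_scalar, OF sl2.\<eta>.zero]
    poly_ev_pCons[where \<eta> = ?e, OF e.zero]
  have H: "sl2_Xm * sl2_H = (sl2_H + 2) * sl2_Xm"
    by (simp add: distrib_right sl2_H_Xm)
  have e: "sl2_Xm * ?e q = ?e (pcompose q [:2, 1:]) * sl2_Xm" for q
  proof (induction q)
    case (pCons a q)
    have "?e (pcompose (pCons a q) [:2, 1:]) = sl2_scalar a + ?e (pcompose q [:2, 1:]) * (sl2_H + 2)"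
      by (simp add: pcompose_pCons e.add mult.commute[of "[:2, 1:]"] del: mult_pCons_left mult_pCons_right)
        (simp add: e.mult ev_pCons poly_ev_0 sl2.\<eta>.ring_ops add.commute del: mult_pCons_left mult_pCons_right)
    moreover have "sl2_Xm * ?e (pCons a q) = sl2_Xm * sl2_scalar a + (sl2_Xm * ?e q) * sl2_H"
      by (simp add: ev_pCons distrib_left mult.assoc)
    moreover have "sl2_Xm * ?e q * sl2_H = ?e (pcompose q [:2, 1:]) * (sl2_H + 2) * sl2_Xm"
      unfolding pCons.IH by (simp add: mult.assoc H)
    ultimately show ?case
      by (simp add: distrib_right sl2.central)
  qed (simp add: poly_ev_0 sl2.\<eta>.zero)
  show ?thesis
    unfolding sl2_ev_def
  proof (induction p)
    case (pCons a p)
    have "sl2_Xm * (poly_ev ?e sl2_C p * sl2_C) = poly_ev ?e sl2_C (shift_H p) * sl2_C * sl2_Xm"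
      using pCons.IH sl2_C_Xm by (metis mult.assoc)
    then show ?case
      by (simp add: shift_H_pCons poly_ev_pCons[where \<eta> = ?e, OF e.zero] distrib_left distrib_right e)
  qed (simp add: shift_H_0 poly_ev_0 e.zero)
qed

section \<open>The homomorphism into \<open>U(sl\<^sub>2)[[h,h']]\<close>\<close>

interpretation hh_const: unital_hom hh_const by (rule unital_hom_hh_const)

abbreviation (input) sl2_subst :: "complex poly poly \<Rightarrow> U_sl2" where
  "sl2_subst \<equiv> subst_HC sl2_scalar sl2_H sl2_C"

lemma sl2_subst_one: "sl2_subst 1 = 1"
proof -
  have "halve_poly (1 :: complex poly poly) = 1"
    by (rule poly_eqI) (simp add: coeff_halve_poly coeff_1)
  then show ?thesis by (simp add: subst_HC_sl2 sl2_ev.one)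
qed

lemma sl2_subst_commute:
  "sl2_H * sl2_subst p = sl2_subst p * sl2_H" "sl2_C * sl2_subst p = sl2_subst p * sl2_C"
proof -
  have comm: "sl2_ev q * sl2_subst p = sl2_subst p * sl2_ev q" for q
    by (simp add: subst_HC_sl2 mult.commute flip: sl2_ev.mult)
  have "sl2_ev [:[:0, 1:]:] = sl2_H" "sl2_ev [:0, 1:] = sl2_C"
    by (simp_all add: sl2_ev_def poly_ev_def sl2.\<eta>.ring_ops)
  then show "sl2_H * sl2_subst p = sl2_subst p * sl2_H" "sl2_C * sl2_subst p = sl2_subst p * sl2_C"
    using comm[of "[:[:0, 1:]:]"] comm[of "[:0, 1:]"] by simp_all
qed

lemma hh_const_mult_map:
  assumes "\<And>p. a * E p = E' p * a"
  shows "hh_const a * hh_map E f = hh_map E' f * hh_const a"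
  by (intro fps_ext) (simp add: hh_const_def hh_map_def assms)

text \<open>The substitution is multiplicative here since \<open>H\<^sub>1 H\<^sub>-\<^sub>1\<close> is even in \<open>\<surd>C\<close>.\<close>

lemma sl2_subst_relation_series:
  "hh_map sl2_subst (relation_series g s) =
    hh_map sl2_subst (ratio_pair g s) * hh_const (sl2_subst (H_e_pair s))"
proof -
  have even: "coeff (H_e_pair s) n = 0" if "odd n" for n
    using that by (auto simp: H_e_pair_def coeff_pCons odd_pos split: nat.split)
  have "hh_map sl2_subst (relation_series g s) =
      hh_const (sl2_subst (H_e_pair s)) * hh_map sl2_subst (ratio_pair g s)"
    unfolding relation_series_eq
  proof (rule hh_map_mult_even)
    show "sl2_subst (p + q) = sl2_subst p + sl2_subst q" for p q
    proof -
      have "halve_poly (p + q) = halve_poly p + halve_poly q"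
        by (rule poly_eqI) (simp add: coeff_halve_poly)
      then show ?thesis by (simp add: subst_HC_sl2 sl2_ev.add)
    qed
    show "sl2_subst (p * q) = sl2_subst p * sl2_subst q" if "\<And>n. odd n \<Longrightarrow> coeff p n = 0" for p q
      using that by (simp add: subst_HC_sl2 halve_poly_mult sl2_ev.mult)
  qed (rule even)
  then show ?thesis
    by (simp add: hh_const_mult_map[where E' = sl2_subst] subst_HC_sl2 mult.commute flip: sl2_ev.mult)
qed

fun psi_gen :: "nat \<Rightarrow> U_gen \<Rightarrow> U_sl2 fps fps" where
  "psi_gen g GXp = hh_map sl2_subst (psi_series g) * hh_const sl2_Xp"
| "psi_gen g GXm = hh_const sl2_Xm"
| "psi_gen g GH = hh_const sl2_H"
| "psi_gen g GC = hh_const sl2_C"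

definition psi_hom :: "nat \<Rightarrow> U_gen free_algebra \<Rightarrow> U_sl2 fps fps" where
  "psi_hom g = free_hom (\<lambda>c. hh_const (sl2_scalar c)) (psi_gen g)"

definition psi_map :: "nat \<Rightarrow> U_free \<Rightarrow> U_sl2 fps fps" where
  "psi_map g = hh_lift (psi_hom g)"

interpretation hh_scalars: central_scalars "\<lambda>c. hh_const (sl2_scalar c)"
  by unfold_locales
    (simp_all add: sl2.\<eta>.ring_ops hh_const.ring_ops, intro fps_ext, simp add: hh_const_def sl2.central)

lemma unital_hom_psi_hom: "unital_hom (psi_hom g)"
  unfolding psi_hom_def by (rule hh_scalars.unital_hom_free_hom)

interpretation psi_hom: unital_hom "psi_hom g" for g by (rule unital_hom_psi_hom)

interpretation psi_map: unital_hom "psi_map g" for g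
  unfolding psi_map_def by (intro unital_hom_hh_lift unital_hom_psi_hom)

lemma psi_hom_scalar: "psi_hom g (free_scalar c) = hh_const (sl2_scalar c)"
  by (simp add: psi_hom_def hh_scalars.free_hom_scalar)

lemma psi_hom_gen: "psi_hom g (free_gen x) = psi_gen g x"
  by (simp add: psi_hom_def hh_scalars.free_hom_gen)

lemma psi_map_const: "psi_map g (hh_const a) = psi_hom g a"
  by (simp add: psi_map_def hh_lift_const[OF unital_hom_psi_hom])

lemma psi_map_gen: "psi_map g (U_free_gen x) = psi_gen g x"
  by (simp add: U_free_gen_def psi_map_const psi_hom_gen)

lemma psi_map_h: "psi_map g hh_h = hh_h" and psi_map_h': "psi_map g hh_h' = hh_h'"
  by (simp_all add: psi_map_def hh_lift_h hh_lift_h' unital_hom_psi_hom)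

lemma psi_map_scalar: "psi_map g (hh_map free_scalar c) = hh_map sl2_scalar c"
  unfolding psi_map_def by (intro hh_lift_scalar_series unital_hom_psi_hom psi_hom_scalar)

lemma psi_map_subst:
  "psi_map g (hh_map (subst_HC free_scalar (free_gen GH) (free_gen GC)) f) = hh_map sl2_subst f"
  unfolding psi_map_def
proof (intro hh_lift_scalar_series unital_hom_psi_hom)
  show "psi_hom g (subst_HC free_scalar (free_gen GH) (free_gen GC) p) = hh_const (sl2_subst p)" for p
    by (simp add: subst_HC_def psi_hom.sum psi_hom.ring_ops psi_hom_scalar psi_hom_gen
        hh_const.sum hh_const.ring_ops)
qed

text \<open>By \<open>relation_series_eq\<close> the rescaling of \<open>X\<^sup>+\<close> accounts exactly for the relation on \<open>X\<^sup>+ X\<^sup>-\<close>.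
  In \<open>X\<^sup>- X\<^sup>+\<close> the scaling factor first has to be moved to the left of \<open>X\<^sup>-\<close>, which shifts \<open>H\<close> by \<open>2\<close>
  and gives the factor that belongs to \<open>H\<^sub>e\<^sup>-\<close>.\<close>

lemma psi_map_relations:
  assumes "r \<in> U_relations g"
  shows "psi_map g r = 0"
proof -
  let ?F = "hh_map sl2_subst (psi_series g)"
  have C: "hh_const sl2_C * ?F = ?F * hh_const sl2_C" and H: "hh_const sl2_H * ?F = ?F * hh_const sl2_H"
    by (intro hh_const_mult_map sl2_subst_commute)+
  have C_Xp: "hh_const sl2_C * (?F * hh_const sl2_Xp) = ?F * hh_const sl2_Xp * hh_const sl2_C"
  proof -
    have "hh_const sl2_C * (?F * hh_const sl2_Xp) = ?F * hh_const (sl2_C * sl2_Xp)"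
      by (simp add: C hh_const.mult flip: mult.assoc)
    then show ?thesis by (simp add: sl2_C_Xp hh_const.mult mult.assoc)
  qed
  have H_Xp: "hh_const sl2_H * (?F * hh_const sl2_Xp) =
      ?F * hh_const sl2_Xp * hh_const sl2_H + 2 * (?F * hh_const sl2_Xp)"
  proof -
    have "hh_const sl2_H * (?F * hh_const sl2_Xp) = ?F * hh_const (sl2_H * sl2_Xp)"
      by (simp add: H hh_const.mult flip: mult.assoc)
    then show ?thesis
      by (simp add: sl2_H_Xp hh_const.ring_ops distrib_left mult.assoc mult_2)
  qed
  have Xp_Xm: "?F * hh_const sl2_Xp * hh_const sl2_Xm = hh_map sl2_subst (relation_series g 1)"
    by (simp add: sl2_subst_relation_series psi_series_eq subst_HC_sl2_H_e_pair hh_const.mult mult.assoc)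
  have "hh_const sl2_Xm * ?F = hh_map (\<lambda>p. sl2_subst (shift_H p)) (psi_series g) * hh_const sl2_Xm"
    by (rule hh_const_mult_map) (simp add: subst_HC_sl2 sl2_Xm_ev halve_poly_shift_H)
  also have "hh_map (\<lambda>p. sl2_subst (shift_H p)) (psi_series g) = hh_map sl2_subst (ratio_pair g (- 1))"
    unfolding psi_series_eq ratio_pair_shift[symmetric] by (intro fps_ext) (simp add: hh_map_def)
  finally have Xm_Xp: "hh_const sl2_Xm * (?F * hh_const sl2_Xp) = hh_map sl2_subst (relation_series g (- 1))"
    by (simp add: sl2_subst_relation_series subst_HC_sl2_H_e_pair hh_const.mult flip: mult.assoc)
  have C_Xm: "hh_const sl2_C * hh_const sl2_Xm = hh_const sl2_Xm * hh_const sl2_C"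
    and C_H: "hh_const sl2_C * hh_const sl2_H = hh_const sl2_H * hh_const sl2_C"
    by (simp_all add: sl2_C_Xm sl2_C_H flip: hh_const.mult)
  have H_Xm: "hh_const sl2_H * hh_const sl2_Xm = hh_const sl2_Xm * hh_const sl2_H - 2 * hh_const sl2_Xm"
    using arg_cong[OF sl2_H_Xm, of hh_const] by (simp add: hh_const.ring_ops)
  note simps = psi_map.ring_ops psi_map_gen psi_map_subst psi_gen.simps
  show ?thesis
    using assms unfolding U_relations_def Let_def
    by (elim insertE emptyE; hypsubst)
      (simp_all only: simps C_Xp H_Xp Xp_Xm Xm_Xp C_Xm C_H H_Xm, simp_all)
qed

lemma psi_map_U_ideal:
  assumes "f \<in> U_ideal g"
  shows "psi_map g f = 0"
  using psi_map.genideal_le_kernel[OF psi_map_relations] assms unfolding U_ideal_def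
  by (rule hh_closure_kernel[OF psi_map.unital_hom_axioms psi_map_h psi_map_h'])


section \<open>The kernel of the homomorphism\<close>

text \<open>Modulo \<open>(h,h')\<close> the deformed relations have to be compared with the presentation of \<open>U(sl\<^sub>2)\<close>, which
  has the three generators \<open>X\<^sup>+, X\<^sup>-, H\<close> only. This map between the free algebras induces the inverse of the
  isomorphism modulo \<open>(h,h')\<close>.\<close>

definition sl2_embed :: "sl2_gen free_algebra \<Rightarrow> U_gen free_algebra" where
  "sl2_embed = free_hom free_scalar
    (\<lambda>x. case x of SXp \<Rightarrow> free_gen GXp | SXm \<Rightarrow> free_gen GXm | SH \<Rightarrow> free_gen GH)"

interpretation sl2_embed: unital_hom sl2_embed
  unfolding sl2_embed_def by (rule free_scalar.unital_hom_free_hom)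

lemma sl2_embed_simps:
  "sl2_embed (free_scalar c) = free_scalar c" "sl2_embed (free_gen SXp) = free_gen GXp"
  "sl2_embed (free_gen SXm) = free_gen GXm" "sl2_embed (free_gen SH) = free_gen GH"
  by (simp_all add: sl2_embed_def free_scalar.free_hom_scalar free_scalar.free_hom_gen)

lemma unital_hom_nth_0: "unital_hom (\<lambda>f :: 'a :: ring_1 fps fps. f $ 0 $ 0)"
  by unfold_locales simp_all

text \<open>Modulo \<open>(h,h')\<close> the scaling factor of \<open>X\<^sup>+\<close> is \<open>1\<close>, hence the generators have their classical images.\<close>

lemma psi_hom_nth_0: "psi_hom g (sl2_embed x) $ 0 $ 0 = abs_U_sl2 x"
proof (rule free_algebra_hom_eqI[where f = "\<lambda>x. psi_hom g (sl2_embed x) $ 0 $ 0"])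
  show "unital_hom (\<lambda>x. psi_hom g (sl2_embed x) $ 0 $ 0)"
    by unfold_locales (simp_all add: sl2_embed.ring_ops psi_hom.ring_ops)
  show "psi_hom g (sl2_embed (free_scalar c)) $ 0 $ 0 = abs_U_sl2 (free_scalar c)" for c
    by (simp add: sl2_embed_simps psi_hom_scalar hh_const_def sl2_scalar_def)
  have "psi_series g $ 0 $ 0 = 1" by (simp add: psi_series_eq ratio_pair_nth_0)
  then show "psi_hom g (sl2_embed (free_gen a)) $ 0 $ 0 = abs_U_sl2 (free_gen a)" for a
    by (cases a) (simp_all add: sl2_embed_simps psi_hom_gen hh_const_def hh_map_def sl2_subst_one
        flip: sl2_Xp_def sl2_Xm_def sl2_H_def)
qed (rule unital_hom_abs_U_sl2)

lemma surj_psi_map: "surj (psi_map g)"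
  unfolding psi_map_def
proof (rule surj_hh_lift)
  show "surj (\<lambda>x. psi_hom g x $ 0 $ 0)"
    unfolding surj_def
  proof
    fix y
    obtain x where "y = abs_U_sl2 x" using surj_abs_U_sl2 by blast
    then show "\<exists>x. y = psi_hom g x $ 0 $ 0" using psi_hom_nth_0[of g x] by metis
  qed
qed

text \<open>The reduction modulo \<open>(h,h')\<close> of the ideal generated by the relations.\<close>

definition leading_ideal :: "nat \<Rightarrow> U_gen free_algebra set" where
  "leading_ideal g = (\<lambda>f. f $ 0 $ 0) ` genideal ring_of_type_algebra (U_relations g)"

lemma ideal_leading_ideal: "ideal (leading_ideal g) ring_of_type_algebra"
proof (rule ideal_of_type_algebraI)
  note I = ideal_of_type_algebraD[OF ideal_genideal[of "U_relations g"]]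
  show "0 \<in> leading_ideal g"
    unfolding leading_ideal_def using I(1) by (intro image_eqI[of _ _ 0]) simp_all
  fix x y
  assume x: "x \<in> leading_ideal g"
  then obtain s where s: "s \<in> genideal ring_of_type_algebra (U_relations g)" "x = s $ 0 $ 0"
    unfolding leading_ideal_def by blast
  show "x + y \<in> leading_ideal g" if "y \<in> leading_ideal g"
  proof -
    obtain t where t: "t \<in> genideal ring_of_type_algebra (U_relations g)" "y = t $ 0 $ 0"
      using \<open>y \<in> leading_ideal g\<close> unfolding leading_ideal_def by blast
    show ?thesis
      unfolding leading_ideal_def using I(2)[OF s(1) t(1)] s t by (intro image_eqI[of _ _ "s + t"]) simp_all
  qed
  show "y * x \<in> leading_ideal g"
    unfolding leading_ideal_def using I(3)[OF s(1), of "hh_const y"] s(2)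
    by (intro image_eqI[of _ _ "hh_const y * s"]) (simp_all add: hh_const_def)
  show "x * y \<in> leading_ideal g"
    unfolding leading_ideal_def using I(4)[OF s(1), of "hh_const y"] s(2)
    by (intro image_eqI[of _ _ "s * hh_const y"]) (simp_all add: hh_const_def)
qed

lemmas leading_idealD = ideal_of_type_algebraD[OF ideal_leading_ideal]

text \<open>The difference of the two relations on \<open>X\<^sup>+ X\<^sup>-\<close> and \<open>X\<^sup>- X\<^sup>+\<close> is the classical commutation relation,
  and the second one determines \<open>C\<close>.\<close>

lemma leading_relations:
  fixes g :: nat
  defines "Xp \<equiv> free_gen GXp" and "Xm \<equiv> free_gen GXm" and "H \<equiv> free_gen GH" and "C \<equiv> free_gen GC"
  shows "H * Xp - Xp * H - 2 * Xp \<in> leading_ideal g" "H * Xm - Xm * H + 2 * Xm \<in> leading_ideal g"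
    "Xp * Xm - Xm * Xp - H \<in> leading_ideal g" "C - ((H + 1)\<^sup>2 + 4 * (Xm * Xp)) \<in> leading_ideal g"
proof -
  let ?a = "\<lambda>s. subst_HC free_scalar H C (H_e_pair s)"
  have lead: "r $ 0 $ 0 \<in> leading_ideal g" if "r \<in> U_relations g" for r
    unfolding leading_ideal_def using genideal_incl that by blast
  have two: "(2 :: U_free) $ 0 $ 0 = 2"
    using unital_hom.numeral[OF unital_hom_nth_0] by blast
  have gen: "U_free_gen x $ 0 $ 0 = free_gen x" for x
    by (simp add: U_free_gen_def hh_const_def)
  have ev: "hh_map \<phi> (relation_series g s) $ 0 $ 0 = \<phi> (H_e_pair s)" for \<phi> :: "_ \<Rightarrow> U_gen free_algebra" and s
    by (simp add: hh_map_def relation_series_nth_0)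
  show "H * Xp - Xp * H - 2 * Xp \<in> leading_ideal g"
    using lead[of "U_free_gen GH * U_free_gen GXp - U_free_gen GXp * U_free_gen GH - 2 * U_free_gen GXp"]
    by (simp add: U_relations_def Let_def gen two Xp_def H_def)
  show "H * Xm - Xm * H + 2 * Xm \<in> leading_ideal g"
    using lead[of "U_free_gen GH * U_free_gen GXm - U_free_gen GXm * U_free_gen GH + 2 * U_free_gen GXm"]
    by (simp add: U_relations_def Let_def gen two Xm_def H_def)
  have p: "Xp * Xm - ?a 1 \<in> leading_ideal g"
    using lead[of "U_free_gen GXp * U_free_gen GXm -
        hh_map (subst_HC free_scalar (free_gen GH) (free_gen GC)) (relation_series g 1)"]
    by (simp add: U_relations_def Let_def gen ev Xp_def Xm_def H_def C_def)
  have m: "Xm * Xp - ?a (- 1) \<in> leading_ideal g"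
    using lead[of "U_free_gen GXm * U_free_gen GXp -
        hh_map (subst_HC free_scalar (free_gen GH) (free_gen GC)) (relation_series g (- 1))"]
    by (simp add: U_relations_def Let_def gen ev Xp_def Xm_def H_def C_def)
  have "(Xp * Xm - ?a 1) - (Xm * Xp - ?a (- 1)) = Xp * Xm - Xm * Xp - (?a 1 - ?a (- 1))"
    by simp
  also have "?a 1 - ?a (- 1) = H" by (rule free_scalar.subst_HC_H_e_pair_diff)
  finally show "Xp * Xm - Xm * Xp - H \<in> leading_ideal g"
    using leading_idealD(6)[OF p m] by (simp only:)
  have "(- 4) * (Xm * Xp - ?a (- 1)) = 4 * ?a (- 1) - 4 * (Xm * Xp)"
    by (simp add: right_diff_distrib)
  also have "4 * ?a (- 1) = C - (H + 1)\<^sup>2"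
    unfolding free_scalar.subst_HC_H_e_pair free_scalar.quarter
    by (simp add: free_scalar.ring_ops)
  finally have "(- 4) * (Xm * Xp - ?a (- 1)) = C - ((H + 1)\<^sup>2 + 4 * (Xm * Xp))" by simp
  then show "C - ((H + 1)\<^sup>2 + 4 * (Xm * Xp)) \<in> leading_ideal g"
    using leading_idealD(3)[OF m, of "- 4"] by (simp only:)
qed

lemma sl2_embed_ideal:
  assumes "x \<in> sl2_ideal"
  shows "sl2_embed x \<in> leading_ideal g"
proof -
  have "ideal {x. sl2_embed x \<in> leading_ideal g} ring_of_type_algebra"
    by (rule ideal_of_type_algebraI) (simp_all add: sl2_embed.ring_ops leading_idealD)
  then have "sl2_ideal \<subseteq> {x. sl2_embed x \<in> leading_ideal g}"
    unfolding sl2_ideal_def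
    by (rule genideal_subset)
      (auto simp: sl2_relations_def Let_def sl2_embed.ring_ops sl2_embed_simps leading_relations)
  then show ?thesis using assms by blast
qed

text \<open>The generator \<open>C\<close> is redundant modulo \<open>(h,h')\<close>, since it is congruent to the Casimir element.\<close>

lemma sl2_embed_mod_leading: "\<exists>y. x - sl2_embed y \<in> leading_ideal g"
proof (induction x rule: free_algebra_induct)
  case (scalar c)
  show ?case by (intro exI[of _ "free_scalar c"]) (simp add: sl2_embed_simps leading_idealD)
next
  case (gen a)
  show ?case
  proof (cases a)
    case GXp
    then show ?thesis by (intro exI[of _ "free_gen SXp"]) (simp add: sl2_embed_simps leading_idealD)
  next
    case GXm
    then show ?thesis by (intro exI[of _ "free_gen SXm"]) (simp add: sl2_embed_simps leading_idealD)
  next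
    case GH
    then show ?thesis by (intro exI[of _ "free_gen SH"]) (simp add: sl2_embed_simps leading_idealD)
  next
    case GC
    then show ?thesis
      by (intro exI[of _ "(free_gen SH + 1)\<^sup>2 + 4 * (free_gen SXm * free_gen SXp)"])
        (simp add: sl2_embed.ring_ops sl2_embed_simps leading_relations)
  qed
next
  case (add x x')
  then obtain y y' where "x - sl2_embed y \<in> leading_ideal g" "x' - sl2_embed y' \<in> leading_ideal g"
    by blast
  then have "(x - sl2_embed y) + (x' - sl2_embed y') \<in> leading_ideal g" by (rule leading_idealD)
  then show ?case by (intro exI[of _ "y + y'"]) (simp add: sl2_embed.add algebra_simps)
next
  case (mult x x')
  then obtain y y' where "x - sl2_embed y \<in> leading_ideal g" "x' - sl2_embed y' \<in> leading_ideal g"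
    by blast
  then have "(x - sl2_embed y) * x' + sl2_embed y * (x' - sl2_embed y') \<in> leading_ideal g"
    by (intro leading_idealD(2)[OF leading_idealD(4) leading_idealD(3)])
  then show ?case by (intro exI[of _ "y * y'"]) (simp add: sl2_embed.mult algebra_simps)
qed

text \<open>What \<open>kernel_le_hh_closure\<close> needs is that constant terms of elements of the kernel are constant terms
  of elements of the ideal. Such a constant term is congruent to the image of an element \<open>y\<close> of the free
  algebra on \<open>X\<^sup>+, X\<^sup>-, H\<close>, and \<open>y\<close> vanishes in \<open>U(sl\<^sub>2)\<close>.\<close>

lemma psi_map_kernel: "psi_map g f = 0 \<longleftrightarrow> f \<in> U_ideal g"
proof
  let ?I = "genideal ring_of_type_algebra (U_relations g)"
  have I0: "psi_map g s = 0" if "s \<in> ?I" for s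
    using psi_map.genideal_le_kernel[OF psi_map_relations that] .
  have nth_0: "psi_map g f $ 0 $ 0 = psi_hom g (f $ 0 $ 0) $ 0 $ 0" for f
    by (simp add: psi_map_def hh_lift_nth_0)
  have vanish: "psi_hom g x $ 0 $ 0 = 0" if x: "x \<in> leading_ideal g" for x
  proof -
    obtain s where "s \<in> ?I" "x = s $ 0 $ 0" using x unfolding leading_ideal_def by blast
    then show ?thesis using I0 by (simp flip: nth_0)
  qed
  assume "psi_map g f = 0"
  then show "f \<in> U_ideal g"
    unfolding U_ideal_def
  proof (rule kernel_le_hh_closure[OF psi_map.unital_hom_axioms psi_map_h psi_map_h' surj_psi_map
        ideal_genideal I0, rotated -1])
    fix f assume f: "psi_map g f = 0"
    obtain y where y: "f $ 0 $ 0 - sl2_embed y \<in> leading_ideal g"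
      using sl2_embed_mod_leading by blast
    have "abs_U_sl2 y = psi_hom g (f $ 0 $ 0) $ 0 $ 0 - psi_hom g (f $ 0 $ 0 - sl2_embed y) $ 0 $ 0"
      by (simp add: psi_hom.diff psi_hom_nth_0)
    also have "\<dots> = 0"
      using f vanish[OF y] by (simp flip: nth_0)
    finally have "sl2_embed y \<in> leading_ideal g"
      by (simp add: abs_U_sl2_eq_0 sl2_embed_ideal)
    with y have "(f $ 0 $ 0 - sl2_embed y) + sl2_embed y \<in> leading_ideal g"
      by (rule leading_idealD)
    then show "\<exists>s\<in>?I. s $ 0 $ 0 = f $ 0 $ 0"
      by (auto simp: leading_ideal_def)
  qed
qed (rule psi_map_U_ideal)


section \<open>The isomorphism\<close>

lemma hh_algebra_simps [simp]:
  "carrier (hh_algebra \<eta>) = UNIV"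
  "monoid.mult (hh_algebra \<eta>) = (*)"
  "monoid.one (hh_algebra \<eta>) = 1"
  "ring.zero (hh_algebra \<eta>) = 0"
  "ring.add (hh_algebra \<eta>) = (+)"
  "module.smult (hh_algebra \<eta>) = (\<lambda>c f. hh_map \<eta> c * f)"
  by (simp_all add: hh_algebra_def ring.defs module.defs ring_of_type_algebra_def)

lemma ring_hh_algebra: "ring (hh_algebra \<eta>)"
proof -
  have "\<exists>y. x + y = 0" for x :: "'a fps fps"
    using add.right_inverse by blast
  then show ?thesis
    using add.right_inverse by unfold_locales (auto simp: algebra_simps Units_def)
qed

lemma quotient_algebra_simps [simp]:
  "carrier (quotient_algebra A J) = carrier (A Quot J)"
  "monoid.mult (quotient_algebra A J) = monoid.mult (A Quot J)"
  "monoid.one (quotient_algebra A J) = monoid.one (A Quot J)"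
  "ring.zero (quotient_algebra A J) = ring.zero (A Quot J)"
  "ring.add (quotient_algebra A J) = ring.add (A Quot J)"
  "module.smult (quotient_algebra A J) = (\<lambda>c S. \<Union>x\<in>S. J +>\<^bsub>A\<^esub> (c \<odot>\<^bsub>A\<^esub> x))"
  by (simp_all add: quotient_algebra_def ring.defs module.defs)

lemma hh_algebra_coset: "J +>\<^bsub>hh_algebra \<eta>\<^esub> x = (\<lambda>j. j + x) ` J"
  by (auto simp: a_r_coset_def r_coset_def)

lemma psi_map_coset:
  assumes "S = U_ideal g +>\<^bsub>hh_algebra \<eta>\<^esub> x"
  shows "psi_map g ` S = {psi_map g x}"
proof -
  have "0 \<in> U_ideal g" by (rule ideal_of_type_algebraD(1)[OF ideal_U_ideal])
  then show ?thesis
    by (force simp: assms hh_algebra_coset psi_map.add psi_map_U_ideal)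
qed

definition psi_iso :: "nat \<Rightarrow> U_free set \<Rightarrow> U_sl2 fps fps" where
  "psi_iso g S = the_elem (psi_map g ` S)"

lemma psi_iso_gen: "psi_iso g (U_hh_gen g x) = psi_gen g x"
  by (simp add: psi_iso_def U_hh_gen_def psi_map_coset[OF refl] psi_map_gen)

lemma psi_iso_ring_iso: "psi_iso g \<in> ring_iso (U_hh g) U_sl2_hh"
proof -
  let ?A = "hh_algebra free_scalar :: (complex fps fps, U_free) module"
  have "ring ?A" "ring U_sl2_hh" "psi_map g \<in> ring_hom ?A U_sl2_hh"
    unfolding U_sl2_hh_def by (simp_all add: ring_hh_algebra ring_hom_def psi_map.ring_ops)
  then have hom: "ring_hom_ring ?A U_sl2_hh (psi_map g)"
    by (intro ring_hom_ring.intro ring_hom_ring_axioms.intro)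
  have kernel: "a_kernel ?A U_sl2_hh (psi_map g) = U_ideal g"
    by (simp add: a_kernel_def kernel_def U_sl2_hh_def psi_map_kernel)
  have "psi_map g ` carrier ?A = carrier U_sl2_hh"
    using surj_psi_map by (simp add: U_sl2_hh_def)
  from ring_hom_ring.FactRing_iso_set[OF hom this]
  have "psi_iso g \<in> ring_iso (?A Quot U_ideal g) U_sl2_hh"
    unfolding kernel psi_iso_def .
  then show ?thesis
    by (simp add: ring_iso_def ring_hom_def U_hh_def)
qed

lemma psi_iso_smult:
  assumes "S \<in> carrier (U_hh g)"
  shows "psi_iso g (c \<odot>\<^bsub>U_hh g\<^esub> S) = c \<odot>\<^bsub>U_sl2_hh\<^esub> psi_iso g S"
proof -
  let ?A = "hh_algebra free_scalar :: (complex fps fps, U_free) module"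
  obtain x where x: "S = U_ideal g +>\<^bsub>?A\<^esub> x"
    using assms by (auto simp: U_hh_def FactRing_def A_RCOSETS_def')
  then have image: "psi_map g ` S = {psi_map g x}" by (rule psi_map_coset)
  have "psi_map g ` (c \<odot>\<^bsub>U_hh g\<^esub> S) = (\<Union>y\<in>S. psi_map g ` (U_ideal g +>\<^bsub>?A\<^esub> (c \<odot>\<^bsub>?A\<^esub> y)))"
    by (simp add: U_hh_def image_UN)
  also have "\<dots> = (\<Union>y\<in>S. {hh_map sl2_scalar c * psi_map g y})"
    by (simp add: psi_map_coset[OF refl] psi_map.mult psi_map_scalar)
  also have "\<dots> = (\<lambda>z. hh_map sl2_scalar c * z) ` psi_map g ` S" by auto
  also have "\<dots> = {hh_map sl2_scalar c * psi_map g x}" by (simp add: image)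
  finally show ?thesis by (simp add: psi_iso_def image U_sl2_hh_def)
qed

theorem proposition4p1:
  fixes g :: nat
  assumes "g \<ge> 1"
  shows "\<exists>\<psi> \<in> algebra_iso (U_hh g) U_sl2_hh.
    \<psi> (U_hh_gen g GH) = hh_const sl2_H \<and>
    \<psi> (U_hh_gen g GC) = hh_const sl2_C \<and>
    \<psi> (U_hh_gen g GXm) = hh_const sl2_Xm \<and>
    \<psi> (U_hh_gen g GXp) =
      hh_map (subst_HC sl2_scalar sl2_H sl2_C) (psi_series g) * hh_const sl2_Xp"
proof (rule bexI[of _ "psi_iso g"])
  show "psi_iso g \<in> algebra_iso (U_hh g) U_sl2_hh"
    by (simp add: algebra_iso_def psi_iso_ring_iso psi_iso_smult)
qed (simp add: psi_iso_gen)

end
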